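(* Let $F:\tilde A\to A$ and $F':\tilde A\to A'$ be two covering functors between locally bounded $k$-categories. Suppose that $\tilde A$ is directed and that $F$ and $F'$ have the same fibres on the objects (for objects $\tilde x,\tilde y$ of $\tilde A$: $F\tilde x=F\tilde y$ if and only if $F'\tilde x=F'\tilde y$). Then $A$ is distributive (resp. regular) if and only if $A'$ is distributive (resp. regular). In that case the stem categories $\hat A$ and $\hat A'$ are equivalent and therefore also the ray categories $\vec A$ and $\vec A'$.
   Context: $k$ is an algebraically closed field. A locally bounded $k$-category $A$ is a $k$-linear category in which distinct objects are non-isomorphic, all $A(x,y)$ are finite dimensional, all $A(x,x)$ are local, and for each $x$ only finitely many $y$ satisfy $A(x,y)\neq 0$ or $A(y,x)\neq 0$. It is directed if its quiver contains no oriented cycle. A $k$-linear functor $F:M\to N$ is a covering functor if it is surjective on objects and for all $m\in M$, $n\in N$ it induces isomorphisms $\bigoplus_{Fm'=n}M(m,m')\to N(Fm,n)$ and $\bigoplus_{Fm'=n}M(m',m)\to N(n,Fm)$. A locally bounded category $A$ is distributive if for all $x$ one has $A(x,x)\simeq k[T]/(T^{n_x})$ for some $n_x$, and for all $x,y$ the space $A(x,y)$ is cyclic as a right $A(x,x)$-module or as a left $A(y,y)$-module. It is regular if moreover all $A(x,y)$ are cyclic from both sides. For a distributive $A$ let $N(y)$ be the radical of $A(y,y)$. For $A(y,y)$-$A(x,x)$-subbimodules $J\subseteq A(x,y)$ and $J'\subseteq A(y,z)$ (subbimodule over $A(z,z)$ and $A(y,y)$) let $J'\cdot J$ be the subbimodule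 of $A(x,z)$ generated by all compositions $j'j$. The stem category $\hat A$ and the ray category $\vec A$ have the same objects as $A$, and their morphisms from $x$ to $y$ are the subbimodules of $A(x,y)$. In $\hat A$ the composition is $J'\cdot J$. In $\vec A$ the composition is $J'*J=J'\cdot J$ unless $J'\cdot N(y)\cdot J=J'\cdot J\ne0$, in which case $J'*J=0$. *)

theory Defs
  imports Complex_Main "HOL-Computational_Algebra.Polynomial" "HOL.Hull"
begin

section \<open>Categories, functors and equivalences\<close>

text \<open>
  Hom-sets of different pairs of objects may overlap, so composition and the action of a functor
  on morphisms are indexed by the objects involved. \<open>Comp C x y z g f\<close> is \<open>g \<circ> f\<close> for
  \<open>f : x \<rightarrow> y\<close> and \<open>g : y \<rightarrow> z\<close>. Nothing is required of the operations outside of the objects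
  and hom-sets.
\<close>

record ('o, 'm) category =
  Obj :: "'o set"
  Hom :: "'o \<Rightarrow> 'o \<Rightarrow> 'm set"
  Comp :: "'o \<Rightarrow> 'o \<Rightarrow> 'o \<Rightarrow> 'm \<Rightarrow> 'm \<Rightarrow> 'm"
  Ide :: "'o \<Rightarrow> 'm"

definition is_category :: "('o, 'm, 'z) category_scheme \<Rightarrow> bool" where
  "is_category C \<longleftrightarrow>
     (\<forall>x\<in>Obj C. Ide C x \<in> Hom C x x) \<and>
     (\<forall>x\<in>Obj C. \<forall>y\<in>Obj C. \<forall>z\<in>Obj C. \<forall>f\<in>Hom C x y. \<forall>g\<in>Hom C y z.
        Comp C x y z g f \<in> Hom C x z) \<and>
     (\<forall>x\<in>Obj C. \<forall>y\<in>Obj C. \<forall>f\<in>Hom C x y.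
        Comp C x x y f (Ide C x) = f \<and> Comp C x y y (Ide C y) f = f) \<and>
     (\<forall>w\<in>Obj C. \<forall>x\<in>Obj C. \<forall>y\<in>Obj C. \<forall>z\<in>Obj C.
        \<forall>f\<in>Hom C w x. \<forall>g\<in>Hom C x y. \<forall>h\<in>Hom C y z.
        Comp C w x z (Comp C x y z h g) f = Comp C w y z h (Comp C w x y g f))"

definition invertible :: "('o, 'm, 'z) category_scheme \<Rightarrow> 'o \<Rightarrow> 'o \<Rightarrow> 'm \<Rightarrow> bool" where
  "invertible C x y f \<longleftrightarrow> f \<in> Hom C x y \<and>
     (\<exists>g\<in>Hom C y x. Comp C x y x g f = Ide C x \<and> Comp C y x y f g = Ide C y)"

definition isomorphic :: "('o, 'm, 'z) category_scheme \<Rightarrow> 'o \<Rightarrow> 'o \<Rightarrow> bool" where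
  "isomorphic C x y \<longleftrightarrow> (\<exists>f. invertible C x y f)"

record ('o, 'm, 'p, 'n) cat_functor =
  FObj :: "'o \<Rightarrow> 'p"
  FMor :: "'o \<Rightarrow> 'o \<Rightarrow> 'm \<Rightarrow> 'n"

definition is_functor ::
  "('o, 'm, 'z) category_scheme \<Rightarrow> ('p, 'n, 'w) category_scheme \<Rightarrow> ('o, 'm, 'p, 'n) cat_functor \<Rightarrow> bool"
where
  "is_functor C D F \<longleftrightarrow>
     (\<forall>x\<in>Obj C. FObj F x \<in> Obj D) \<and>
     (\<forall>x\<in>Obj C. \<forall>y\<in>Obj C. \<forall>f\<in>Hom C x y. FMor F x y f \<in> Hom D (FObj F x) (FObj F y)) \<and>
     (\<forall>x\<in>Obj C. FMor F x x (Ide C x) = Ide D (FObj F x)) \<and>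
     (\<forall>x\<in>Obj C. \<forall>y\<in>Obj C. \<forall>z\<in>Obj C. \<forall>f\<in>Hom C x y. \<forall>g\<in>Hom C y z.
        FMor F x z (Comp C x y z g f) =
          Comp D (FObj F x) (FObj F y) (FObj F z) (FMor F y z g) (FMor F x y f))"

definition id_functor :: "('o, 'm, 'o, 'm) cat_functor" where
  "id_functor = \<lparr>FObj = (\<lambda>x. x), FMor = (\<lambda>_ _ f. f)\<rparr>"

definition comp_functor ::
  "('p, 'n, 'q, 'l) cat_functor \<Rightarrow> ('o, 'm, 'p, 'n) cat_functor \<Rightarrow> ('o, 'm, 'q, 'l) cat_functor"
where
  "comp_functor G F =
     \<lparr>FObj = (\<lambda>x. FObj G (FObj F x)),
      FMor = (\<lambda>x y f. FMor G (FObj F x) (FObj F y) (FMor F x y f))\<rparr>"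

definition naturally_isomorphic ::
  "('o, 'm, 'z) category_scheme \<Rightarrow> ('p, 'n, 'w) category_scheme \<Rightarrow>
     ('o, 'm, 'p, 'n) cat_functor \<Rightarrow> ('o, 'm, 'p, 'n) cat_functor \<Rightarrow> bool"
where
  "naturally_isomorphic C D F G \<longleftrightarrow>
     (\<exists>\<eta>. (\<forall>x\<in>Obj C. invertible D (FObj F x) (FObj G x) (\<eta> x)) \<and>
          (\<forall>x\<in>Obj C. \<forall>y\<in>Obj C. \<forall>f\<in>Hom C x y.
             Comp D (FObj F x) (FObj F y) (FObj G y) (\<eta> y) (FMor F x y f) =
             Comp D (FObj F x) (FObj G x) (FObj G y) (FMor G x y f) (\<eta> x)))"

definition equivalent_categories ::
  "('o, 'm, 'z) category_scheme \<Rightarrow> ('p, 'n, 'w) category_scheme \<Rightarrow> bool"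
where
  "equivalent_categories C D \<longleftrightarrow>
     is_category C \<and> is_category D \<and>
     (\<exists>F G. is_functor C D F \<and> is_functor D C G \<and>
        naturally_isomorphic C C (comp_functor G F) id_functor \<and>
        naturally_isomorphic D D (comp_functor F G) id_functor)"


section \<open>Linear categories and covering functors\<close>

text \<open>
  The hom-spaces of a \<open>k\<close>-linear category are linear subspaces of one ambient \<open>k\<close>-vector space,
  the type \<open>'m\<close> with scalar multiplication \<open>Scale\<close>. This is no restriction, as any family of vector
  spaces embeds into its direct sum.
\<close>

record ('k, 'o, 'm) kcategory = "('o, 'm) category" +
  Scale :: "'k \<Rightarrow> 'm \<Rightarrow> 'm"

definition linear_category :: "('k::field, 'o, 'm::ab_group_add) kcategory \<Rightarrow> bool" where
  "linear_category A \<longleftrightarrow>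
     is_category A \<and> vector_space (Scale A) \<and>
     (\<forall>x\<in>Obj A. \<forall>y\<in>Obj A. module.subspace (Scale A) (Hom A x y)) \<and>
     (\<forall>x\<in>Obj A. \<forall>y\<in>Obj A. \<forall>z\<in>Obj A. \<forall>f\<in>Hom A x y. \<forall>f'\<in>Hom A x y. \<forall>g\<in>Hom A y z. \<forall>g'\<in>Hom A y z.
        Comp A x y z g (f + f') = Comp A x y z g f + Comp A x y z g f' \<and>
        Comp A x y z (g + g') f = Comp A x y z g f + Comp A x y z g' f) \<and>
     (\<forall>x\<in>Obj A. \<forall>y\<in>Obj A. \<forall>z\<in>Obj A. \<forall>f\<in>Hom A x y. \<forall>g\<in>Hom A y z. \<forall>c.
        Comp A x y z g (Scale A c f) = Scale A c (Comp A x y z g f) \<and>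
        Comp A x y z (Scale A c g) f = Scale A c (Comp A x y z g f))"

definition local_endomorphisms :: "('k::field, 'o, 'm::ab_group_add) kcategory \<Rightarrow> 'o \<Rightarrow> bool" where
  "local_endomorphisms A x \<longleftrightarrow>
     Ide A x \<noteq> 0 \<and>
     (\<forall>f\<in>Hom A x x. \<forall>g\<in>Hom A x x.
        \<not> invertible A x x f \<and> \<not> invertible A x x g \<longrightarrow> \<not> invertible A x x (f + g))"

definition locally_bounded :: "('k::field, 'o, 'm::ab_group_add) kcategory \<Rightarrow> bool" where
  "locally_bounded A \<longleftrightarrow>
     linear_category A \<and>
     (\<forall>x\<in>Obj A. \<forall>y\<in>Obj A. x \<noteq> y \<longrightarrow> \<not> isomorphic A x y) \<and>
     (\<forall>x\<in>Obj A. \<forall>y\<in>Obj A. \<exists>B. finite B \<and> module.span (Scale A) B = Hom A x y) \<and>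
     (\<forall>x\<in>Obj A. local_endomorphisms A x) \<and>
     (\<forall>x\<in>Obj A. finite {y \<in> Obj A. Hom A x y \<noteq> {0} \<or> Hom A y x \<noteq> {0}})"

text \<open>
  The radical of the category; \<open>radical A x x\<close> is the Jacobson radical of the ring \<open>A(x,x)\<close>.
\<close>

definition radical :: "('k::field, 'o, 'm::ab_group_add) kcategory \<Rightarrow> 'o \<Rightarrow> 'o \<Rightarrow> 'm set" where
  "radical A x y =
     {f \<in> Hom A x y. \<forall>g\<in>Hom A y x. invertible A x x (Ide A x - Comp A x y x g f)}"

definition radical_square :: "('k::field, 'o, 'm::ab_group_add) kcategory \<Rightarrow> 'o \<Rightarrow> 'o \<Rightarrow> 'm set" where
  "radical_square A x y =
     module.span (Scale A)
       {Comp A x z y g f | z f g. z \<in> Obj A \<and> f \<in> radical A x z \<and> g \<in> radical A z y}"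

text \<open>
  The quiver of \<open>A\<close> has \<open>dim (rad A(x,y) / rad\<^sup>2 A(x,y))\<close> arrows from \<open>x\<close> to \<open>y\<close>. For oriented
  cycles (loops included) it only matters whether there is an arrow, so multiplicities are dropped.
\<close>

definition quiver :: "('k::field, 'o, 'm::ab_group_add) kcategory \<Rightarrow> ('o \<times> 'o) set" where
  "quiver A = {(x, y). x \<in> Obj A \<and> y \<in> Obj A \<and> radical_square A x y \<noteq> radical A x y}"

definition directed :: "('k::field, 'o, 'm::ab_group_add) kcategory \<Rightarrow> bool" where
  "directed A \<longleftrightarrow> acyclic (quiver A)"

definition linear_functor ::
  "('k::field, 'o, 'm::ab_group_add) kcategory \<Rightarrow> ('k, 'p, 'n::ab_group_add) kcategory \<Rightarrow>
     ('o, 'm, 'p, 'n) cat_functor \<Rightarrow> bool"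
where
  "linear_functor M N F \<longleftrightarrow>
     is_functor M N F \<and>
     (\<forall>x\<in>Obj M. \<forall>y\<in>Obj M. \<forall>f\<in>Hom M x y. \<forall>g\<in>Hom M x y.
        FMor F x y (f + g) = FMor F x y f + FMor F x y g) \<and>
     (\<forall>x\<in>Obj M. \<forall>y\<in>Obj M. \<forall>f\<in>Hom M x y. \<forall>c.
        FMor F x y (Scale M c f) = Scale N c (FMor F x y f))"

definition direct_sum :: "'i set \<Rightarrow> ('i \<Rightarrow> 'm::ab_group_add set) \<Rightarrow> ('i \<Rightarrow> 'm) set" where
  "direct_sum I V =
     {f. (\<forall>i\<in>I. f i \<in> V i) \<and> (\<forall>i. i \<notin> I \<longrightarrow> f i = 0) \<and> finite {i. f i \<noteq> 0}}"

definition fibre ::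
  "('o, 'm, 'z) category_scheme \<Rightarrow> ('o, 'm, 'p, 'n) cat_functor \<Rightarrow> 'p \<Rightarrow> 'o set"
where
  "fibre M F n = {m \<in> Obj M. FObj F m = n}"

text \<open>
  The two maps required to be bijective are linear whenever \<open>F\<close> is, so that bijective means
  isomorphism here.
\<close>

definition covering_functor ::
  "('k::field, 'o, 'm::ab_group_add) kcategory \<Rightarrow> ('k, 'p, 'n::ab_group_add) kcategory \<Rightarrow>
     ('o, 'm, 'p, 'n) cat_functor \<Rightarrow> bool"
where
  "covering_functor M N F \<longleftrightarrow>
     linear_functor M N F \<and>
     FObj F ` Obj M = Obj N \<and>
     (\<forall>m\<in>Obj M. \<forall>n\<in>Obj N.
        bij_betw (\<lambda>f. \<Sum>m' | f m' \<noteq> 0. FMor F m m' (f m'))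
          (direct_sum (fibre M F n) (\<lambda>m'. Hom M m m')) (Hom N (FObj F m) n) \<and>
        bij_betw (\<lambda>f. \<Sum>m' | f m' \<noteq> 0. FMor F m' m (f m'))
          (direct_sum (fibre M F n) (\<lambda>m'. Hom M m' m)) (Hom N n (FObj F m)))"


section \<open>Distributive and regular categories\<close>

text \<open>\<open>k[T]/(T\<^sup>n)\<close> is the set of classes \<open>UNIV // trunc_rel n\<close> with the operations
  inherited from \<open>k[T]\<close>.\<close>

definition trunc_rel :: "nat \<Rightarrow> ('k::field poly \<times> 'k poly) set" where
  "trunc_rel n = {(p, q). monom 1 n dvd p - q}"

definition trunc_class :: "nat \<Rightarrow> 'k::field poly \<Rightarrow> 'k poly set" where
  "trunc_class n p = trunc_rel n `` {p}"

definition endomorphisms_truncated_polynomial ::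
  "('k::field, 'o, 'm::ab_group_add) kcategory \<Rightarrow> 'o \<Rightarrow> nat \<Rightarrow> bool"
where
  "endomorphisms_truncated_polynomial A x n \<longleftrightarrow>
     (\<exists>\<phi>. bij_betw \<phi> (UNIV // trunc_rel n) (Hom A x x) \<and>
        \<phi> (trunc_class n 1) = Ide A x \<and>
        (\<forall>p q. \<phi> (trunc_class n (p + q)) = \<phi> (trunc_class n p) + \<phi> (trunc_class n q)) \<and>
        (\<forall>p q. \<phi> (trunc_class n (p * q)) =
                 Comp A x x x (\<phi> (trunc_class n p)) (\<phi> (trunc_class n q))) \<and>
        (\<forall>c p. \<phi> (trunc_class n (smult c p)) = Scale A c (\<phi> (trunc_class n p))))"

definition cyclic_right :: "('k::field, 'o, 'm::ab_group_add) kcategory \<Rightarrow> 'o \<Rightarrow> 'o \<Rightarrow> bool" where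
  "cyclic_right A x y \<longleftrightarrow> (\<exists>f\<in>Hom A x y. Hom A x y = (\<lambda>a. Comp A x x y f a) ` Hom A x x)"

definition cyclic_left :: "('k::field, 'o, 'm::ab_group_add) kcategory \<Rightarrow> 'o \<Rightarrow> 'o \<Rightarrow> bool" where
  "cyclic_left A x y \<longleftrightarrow> (\<exists>f\<in>Hom A x y. Hom A x y = (\<lambda>b. Comp A x y y b f) ` Hom A y y)"

definition distributive :: "('k::field, 'o, 'm::ab_group_add) kcategory \<Rightarrow> bool" where
  "distributive A \<longleftrightarrow>
     (\<forall>x\<in>Obj A. \<exists>n. endomorphisms_truncated_polynomial A x n) \<and>
     (\<forall>x\<in>Obj A. \<forall>y\<in>Obj A. cyclic_right A x y \<or> cyclic_left A x y)"

definition regular :: "('k::field, 'o, 'm::ab_group_add) kcategory \<Rightarrow> bool" where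
  "regular A \<longleftrightarrow>
     distributive A \<and> (\<forall>x\<in>Obj A. \<forall>y\<in>Obj A. cyclic_right A x y \<and> cyclic_left A x y)"


section \<open>Stem category and ray category\<close>

definition subbimodule ::
  "('k::field, 'o, 'm::ab_group_add) kcategory \<Rightarrow> 'o \<Rightarrow> 'o \<Rightarrow> 'm set \<Rightarrow> bool"
where
  "subbimodule A x y J \<longleftrightarrow>
     J \<subseteq> Hom A x y \<and> module.subspace (Scale A) J \<and>
     (\<forall>j\<in>J. \<forall>a\<in>Hom A x x. Comp A x x y j a \<in> J) \<and>
     (\<forall>j\<in>J. \<forall>b\<in>Hom A y y. Comp A x y y b j \<in> J)"

definition bimodule_product ::
  "('k::field, 'o, 'm::ab_group_add) kcategory \<Rightarrow> 'o \<Rightarrow> 'o \<Rightarrow> 'o \<Rightarrow> 'm set \<Rightarrow> 'm set \<Rightarrow> 'm set"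
where
  "bimodule_product A x y z J' J =
     (subbimodule A x z) hull {Comp A x y z j' j | j' j. j' \<in> J' \<and> j \<in> J}"

definition ray_product ::
  "('k::field, 'o, 'm::ab_group_add) kcategory \<Rightarrow> 'o \<Rightarrow> 'o \<Rightarrow> 'o \<Rightarrow> 'm set \<Rightarrow> 'm set \<Rightarrow> 'm set"
where
  "ray_product A x y z J' J =
     (if bimodule_product A x y z (bimodule_product A y y z J' (radical A y y)) J
           = bimodule_product A x y z J' J
         \<and> bimodule_product A x y z J' J \<noteq> {0}
      then {0} else bimodule_product A x y z J' J)"

definition stem_category ::
  "('k::field, 'o, 'm::ab_group_add) kcategory \<Rightarrow> ('o, 'm set) category"
where
  "stem_category A =
     \<lparr>Obj = Obj A, Hom = (\<lambda>x y. {J. subbimodule A x y J}),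
      Comp = bimodule_product A, Ide = (\<lambda>x. Hom A x x)\<rparr>"

definition ray_category ::
  "('k::field, 'o, 'm::ab_group_add) kcategory \<Rightarrow> ('o, 'm set) category"
where
  "ray_category A =
     \<lparr>Obj = Obj A, Hom = (\<lambda>x y. {J. subbimodule A x y J}),
      Comp = ray_product A, Ide = (\<lambda>x. Hom A x x)\<rparr>"

end

theory Submission
  imports Defs
begin

text \<open>
  For an object \<open>w\<close> of the covering category \<open>M\<close> over \<open>x\<close> and \<open>x'\<close>, the decompositions of \<open>A(x,y)\<close> and \<open>A'(x',y')\<close>
  into the same direct sum of spaces \<open>M(w,m)\<close> give a linear bijection
  \<open>\<Phi>\<^sub>w : A(x,y) \<rightarrow> A'(x',y')\<close>. It depends on \<open>w\<close> and is not multiplicative, but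
  \<open>\<Phi>\<^sub>w(b \<cdot> F f) = \<Phi>\<^sub>m(b) \<cdot> F' f\<close> for \<open>f : w \<rightarrow> m\<close>.
  Call a subbimodule \<open>J\<close> good if for every \<open>w\<close> it is spanned by images of morphisms starting in \<open>w\<close>
  and \<open>\<Phi>\<^sub>w(J)\<close> is a subbimodule that does not depend on \<open>w\<close> (the relation \<open>corresponding\<close> links \<open>J\<close> to it).
  Hom-spaces and radicals are good, and so
  are products of good subbimodules. If a hom-space or a radical is cyclic, then by locality one of
  the homogeneous components of a generator generates it as well, so that cyclicity is
  transported by \<open>\<Phi>\<^sub>w\<close>, in the right-hand case together with Nakayama's lemma. In a
  distributive category every subbimodule of \<open>A(x,y)\<close> is a product of \<open>A(x,y)\<close> with a power of
  the radical of \<open>A(x,x)\<close> or \<open>A(y,y)\<close>, hence good, and \<open>J \<mapsto> \<Phi>\<^sub>w(J)\<close> is an isomorphism of stem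
  and of ray categories.
\<close>

section \<open>Linear categories\<close>

text \<open>The obstacle is that lifting moves the base object: in \<open>b \<cdot> F f\<close> the
  factor \<open>b\<close> has to be lifted from the end point of \<open>f\<close>, not from
  \<open>w\<close>, and the lifts of one element from different objects need not agree. Single
  elements therefore have no consistent counterpart, but a set has one as soon as its image is the
  same from every base object. This is why subbimodules are compared and why independence of
  \<open>w\<close> belongs to being good. The same formula makes the two sides behave differently.
  Left multiples of \<open>F g\<close> go to left multiples of \<open>F' g\<close>, while of the
  image of \<open>F g \<cdot> r\<close> with \<open>r\<close> radical one only knows that it lies in
  the product of the hom-space with the radical; nilpotency has to absorb this error. Radicals are
  good because \<open>M\<close> detects units: a morphism from \<open>w\<close> to another object of
  its fibre never becomes invertible, and an endomorphism of \<open>w\<close> is invertible exactly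
  when its image under \<open>F\<close>, or equally under \<open>F'\<close>, is. A separate point,
  unrelated to coverings, is that the ray product is associative. It rests on Nakayama's lemma and
  on the fact that a proper subbimodule already lies in a product with a radical.\<close>

locale lin_cat =
  fixes A :: "('k::field, 'o, 'm::ab_group_add) kcategory"
  assumes linear: "linear_category A"
begin

sublocale vs: vector_space "Scale A"
  using linear unfolding linear_category_def by blast

lemma cat: "is_category A"
  using linear unfolding linear_category_def by blast

lemma hom_subspace: "x \<in> Obj A \<Longrightarrow> y \<in> Obj A \<Longrightarrow> vs.subspace (Hom A x y)"
  using linear unfolding linear_category_def by blast

lemma ide_in [simp]: "x \<in> Obj A \<Longrightarrow> Ide A x \<in> Hom A x x"
  using cat unfolding is_category_def by blast

lemma comp_in [simp]:
  "x \<in> Obj A \<Longrightarrow> y \<in> Obj A \<Longrightarrow> z \<in> Obj A \<Longrightarrow> f \<in> Hom A x y \<Longrightarrow> g \<in> Hom A y z \<Longrightarrow>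
    Comp A x y z g f \<in> Hom A x z"
  using cat unfolding is_category_def by blast

lemma comp_ide [simp]:
  "x \<in> Obj A \<Longrightarrow> y \<in> Obj A \<Longrightarrow> f \<in> Hom A x y \<Longrightarrow> Comp A x x y f (Ide A x) = f"
  "x \<in> Obj A \<Longrightarrow> y \<in> Obj A \<Longrightarrow> f \<in> Hom A x y \<Longrightarrow> Comp A x y y (Ide A y) f = f"
  using cat unfolding is_category_def by blast+

lemma comp_assoc:
  "w \<in> Obj A \<Longrightarrow> x \<in> Obj A \<Longrightarrow> y \<in> Obj A \<Longrightarrow> z \<in> Obj A \<Longrightarrow>
    f \<in> Hom A w x \<Longrightarrow> g \<in> Hom A x y \<Longrightarrow> h \<in> Hom A y z \<Longrightarrow>
    Comp A w x z (Comp A x y z h g) f = Comp A w y z h (Comp A w x y g f)"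
  using cat unfolding is_category_def by blast

lemma zero_in [simp]: "x \<in> Obj A \<Longrightarrow> y \<in> Obj A \<Longrightarrow> 0 \<in> Hom A x y"
  and add_in [simp]: "x \<in> Obj A \<Longrightarrow> y \<in> Obj A \<Longrightarrow> f \<in> Hom A x y \<Longrightarrow> g \<in> Hom A x y \<Longrightarrow> f + g \<in> Hom A x y"
  and diff_in [simp]: "x \<in> Obj A \<Longrightarrow> y \<in> Obj A \<Longrightarrow> f \<in> Hom A x y \<Longrightarrow> g \<in> Hom A x y \<Longrightarrow> f - g \<in> Hom A x y"
  and neg_in [simp]: "x \<in> Obj A \<Longrightarrow> y \<in> Obj A \<Longrightarrow> f \<in> Hom A x y \<Longrightarrow> - f \<in> Hom A x y"
  and scale_in [simp]: "x \<in> Obj A \<Longrightarrow> y \<in> Obj A \<Longrightarrow> f \<in> Hom A x y \<Longrightarrow> Scale A c f \<in> Hom A x y"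
  by (simp_all add: hom_subspace vs.subspace_0 vs.subspace_neg vs.subspace_add vs.subspace_diff vs.subspace_scale)

lemma comp_add:
  "x \<in> Obj A \<Longrightarrow> y \<in> Obj A \<Longrightarrow> z \<in> Obj A \<Longrightarrow> f \<in> Hom A x y \<Longrightarrow> f' \<in> Hom A x y \<Longrightarrow> g \<in> Hom A y z \<Longrightarrow>
    Comp A x y z g (f + f') = Comp A x y z g f + Comp A x y z g f'"
  "x \<in> Obj A \<Longrightarrow> y \<in> Obj A \<Longrightarrow> z \<in> Obj A \<Longrightarrow> f \<in> Hom A x y \<Longrightarrow> g \<in> Hom A y z \<Longrightarrow> g' \<in> Hom A y z \<Longrightarrow>
    Comp A x y z (g + g') f = Comp A x y z g f + Comp A x y z g' f"
  using linear unfolding linear_category_def by blast+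

lemma comp_scale [simp]:
  "x \<in> Obj A \<Longrightarrow> y \<in> Obj A \<Longrightarrow> z \<in> Obj A \<Longrightarrow> f \<in> Hom A x y \<Longrightarrow> g \<in> Hom A y z \<Longrightarrow>
    Comp A x y z g (Scale A c f) = Scale A c (Comp A x y z g f)"
  "x \<in> Obj A \<Longrightarrow> y \<in> Obj A \<Longrightarrow> z \<in> Obj A \<Longrightarrow> f \<in> Hom A x y \<Longrightarrow> g \<in> Hom A y z \<Longrightarrow>
    Comp A x y z (Scale A c g) f = Scale A c (Comp A x y z g f)"
  using linear unfolding linear_category_def by blast+

lemma comp_diff:
  assumes "x \<in> Obj A" "y \<in> Obj A" "z \<in> Obj A"
  shows "f \<in> Hom A x y \<Longrightarrow> f' \<in> Hom A x y \<Longrightarrow> g \<in> Hom A y z \<Longrightarrow>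
      Comp A x y z g (f - f') = Comp A x y z g f - Comp A x y z g f'"
    and "f \<in> Hom A x y \<Longrightarrow> g \<in> Hom A y z \<Longrightarrow> g' \<in> Hom A y z \<Longrightarrow>
      Comp A x y z (g - g') f = Comp A x y z g f - Comp A x y z g' f"
  using comp_add(1)[OF assms, of "f - f'" f' g] comp_add(2)[OF assms, of f "g - g'" g'] assms
  by (simp_all add: eq_diff_eq)

lemma comp_zero [simp]:
  assumes "x \<in> Obj A" "y \<in> Obj A" "z \<in> Obj A"
  shows "g \<in> Hom A y z \<Longrightarrow> Comp A x y z g 0 = 0"
    and "f \<in> Hom A x y \<Longrightarrow> Comp A x y z 0 f = 0"
  using comp_diff(1)[OF assms, of 0 0 g] comp_diff(2)[OF assms, of f 0 0] assms by simp_all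

section \<open>Subbimodules and their products\<close>

lemma hom_subbimodule: "x \<in> Obj A \<Longrightarrow> y \<in> Obj A \<Longrightarrow> subbimodule A x y (Hom A x y)"
  by (simp add: subbimodule_def hom_subspace)

lemma zero_subbimodule: "x \<in> Obj A \<Longrightarrow> y \<in> Obj A \<Longrightarrow> subbimodule A x y {0}"
  by (simp add: subbimodule_def)

lemma subbimodule_subspace: "subbimodule A x y J \<Longrightarrow> vs.subspace J"
  by (simp add: subbimodule_def)

lemma subbimoduleD:
  assumes "subbimodule A x y J"
  shows "j \<in> J \<Longrightarrow> j \<in> Hom A x y" "0 \<in> J" "j \<in> J \<Longrightarrow> j' \<in> J \<Longrightarrow> j + j' \<in> J"
    "j \<in> J \<Longrightarrow> j' \<in> J \<Longrightarrow> j - j' \<in> J"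
    "j \<in> J \<Longrightarrow> Scale A c j \<in> J" "j \<in> J \<Longrightarrow> a \<in> Hom A x x \<Longrightarrow> Comp A x x y j a \<in> J"
    "j \<in> J \<Longrightarrow> b \<in> Hom A y y \<Longrightarrow> Comp A x y y b j \<in> J"
  using assms by (auto simp: subbimodule_def vs.subspace_0 vs.subspace_add vs.subspace_diff vs.subspace_scale)

text \<open>Membership in the span is carried through the induction, because the laws of composition
  hold only for elements of hom-sets.\<close>

lemma span_cons_induct [consumes 1, case_names zero add]:
  assumes "a \<in> vs.span S" "P 0"
    and "\<And>c s a. s \<in> S \<Longrightarrow> a \<in> vs.span S \<Longrightarrow> P a \<Longrightarrow> P (Scale A c s + a)"
  shows "P a"
proof -
  have "a \<in> vs.span S \<and> P a"
    using assms(1)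
    by (induction rule: vs.span_induct_alt)
      (simp_all add: assms vs.span_zero vs.span_add vs.span_scale vs.span_base)
  then show ?thesis ..
qed

context
  fixes x y z K J
  assumes obj: "x \<in> Obj A" "y \<in> Obj A" "z \<in> Obj A"
    and J: "subbimodule A x y J" and K: "subbimodule A y z K"
begin

text \<open>Either action is absorbed by a factor, \<open>(k j) a = k (j a)\<close> and
  \<open>b (k j) = (b k) j\<close>, so the linear span of the compositions is already closed under
  both rings.\<close>

lemma span_products_subbimodule:
  "subbimodule A x z (vs.span {Comp A x y z k j | k j. k \<in> K \<and> j \<in> J})" (is "subbimodule A x z (vs.span ?S)")
proof -
  have S: "?S \<subseteq> Hom A x z"
    using obj subbimoduleD(1)[OF J] subbimoduleD(1)[OF K] by auto
  have sub: "vs.span ?S \<subseteq> Hom A x z"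
    by (rule vs.span_minimal[OF S hom_subspace[OF obj(1,3)]])
  have "Comp A x x z s a \<in> vs.span ?S" if s: "s \<in> vs.span ?S" and a: "a \<in> Hom A x x" for s a
    using s
  proof (induction rule: span_cons_induct)
    case zero
    then show ?case using obj a by (simp add: vs.span_zero)
  next
    case (add c s s')
    then obtain k j where kj: "s = Comp A x y z k j" "k \<in> K" "j \<in> J" by blast
    have s: "s \<in> Hom A x z" "s' \<in> Hom A x z"
      using S sub add by blast+
    have "Comp A x x z s a = Comp A x y z k (Comp A x x y j a)"
      unfolding kj(1) using obj a kj subbimoduleD(1)[OF J] subbimoduleD(1)[OF K] by (simp add: comp_assoc)
    also have "\<dots> \<in> vs.span ?S"
      using kj(2) subbimoduleD(6)[OF J kj(3) a] by (intro vs.span_base) blast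
    finally show ?case
      using obj a s add by (simp add: comp_add vs.span_add vs.span_scale)
  qed
  moreover have "Comp A x z z b s \<in> vs.span ?S" if s: "s \<in> vs.span ?S" and a: "b \<in> Hom A z z" for s b
    using s
  proof (induction rule: span_cons_induct)
    case zero
    then show ?case using obj a by (simp add: vs.span_zero)
  next
    case (add c s s')
    then obtain k j where kj: "s = Comp A x y z k j" "k \<in> K" "j \<in> J" by blast
    have s: "s \<in> Hom A x z" "s' \<in> Hom A x z"
      using S sub add by blast+
    have "Comp A x z z b s = Comp A x y z (Comp A y z z b k) j"
      unfolding kj(1) using obj a kj subbimoduleD(1)[OF J] subbimoduleD(1)[OF K] by (simp add: comp_assoc)
    also have "\<dots> \<in> vs.span ?S"
      using kj(3) subbimoduleD(7)[OF K kj(2) a] by (intro vs.span_base) blast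
    finally show ?case
      using obj a s add by (simp add: comp_add vs.span_add vs.span_scale)
  qed
  ultimately show ?thesis
    unfolding subbimodule_def using sub vs.subspace_span by blast
qed

lemma bimodule_product_eq_span:
  "bimodule_product A x y z K J = vs.span {Comp A x y z k j | k j. k \<in> K \<and> j \<in> J}"
  unfolding bimodule_product_def
  by (rule hull_unique)
    (rule vs.span_superset span_products_subbimodule vs.span_minimal[OF _ subbimodule_subspace] | assumption)+

lemma product_subbimodule: "subbimodule A x z (bimodule_product A x y z K J)"
  unfolding bimodule_product_eq_span by (rule span_products_subbimodule)

lemma product_in: "k \<in> K \<Longrightarrow> j \<in> J \<Longrightarrow> Comp A x y z k j \<in> bimodule_product A x y z K J"
  unfolding bimodule_product_eq_span by (rule vs.span_base) blast

text \<open>Scalars are absorbed by the left factor, which stays in the subspace \<open>K\<close>; a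
  step therefore adds one plain composition.\<close>

lemma product_induct:
  assumes a: "a \<in> bimodule_product A x y z K J" and 0: "P 0"
    and step: "\<And>k j a. k \<in> K \<Longrightarrow> j \<in> J \<Longrightarrow> a \<in> bimodule_product A x y z K J \<Longrightarrow> P a \<Longrightarrow>
      P (Comp A x y z k j + a)"
  shows "P a"
proof -
  have "a \<in> bimodule_product A x y z K J \<and> P a"
    using a[unfolded bimodule_product_eq_span]
  proof (induction rule: span_cons_induct)
    case zero
    then show ?case using 0 subbimoduleD(2)[OF product_subbimodule] by simp
  next
    case (add c s s')
    then obtain k j where kj: "s = Comp A x y z k j" "k \<in> K" "j \<in> J" by blast
    then have "Scale A c s = Comp A x y z (Scale A c k) j" "Scale A c k \<in> K"
      using obj subbimoduleD[OF J] subbimoduleD[OF K] by simp_all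
    then show ?case
      using add kj step[of "Scale A c k" j s'] product_in subbimoduleD(3)[OF product_subbimodule] by simp
  qed
  then show ?thesis ..
qed

lemma product_least:
  assumes "subbimodule A x z L" "\<And>k j. k \<in> K \<Longrightarrow> j \<in> J \<Longrightarrow> Comp A x y z k j \<in> L"
  shows "bimodule_product A x y z K J \<subseteq> L"
  unfolding bimodule_product_eq_span
  by (rule vs.span_minimal[OF _ subbimodule_subspace[OF assms(1)]]) (use assms(2) in blast)

end

lemma product_mono:
  "K \<subseteq> K' \<Longrightarrow> J \<subseteq> J' \<Longrightarrow> bimodule_product A x y z K J \<subseteq> bimodule_product A x y z K' J'"
  unfolding bimodule_product_def by (rule hull_mono) blast

lemma product_ide_right:
  assumes "x \<in> Obj A" "y \<in> Obj A" "subbimodule A x y J"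
  shows "bimodule_product A x x y J (Hom A x x) = J"
proof
  show "bimodule_product A x x y J (Hom A x x) \<subseteq> J"
    using assms by (intro product_least) (auto simp: hom_subbimodule subbimoduleD)
  show "J \<subseteq> bimodule_product A x x y J (Hom A x x)"
  proof
    fix j assume "j \<in> J"
    then have "Comp A x x y j (Ide A x) \<in> bimodule_product A x x y J (Hom A x x)"
      using assms by (intro product_in) (auto simp: hom_subbimodule)
    then show "j \<in> bimodule_product A x x y J (Hom A x x)"
      using assms \<open>j \<in> J\<close> by (simp add: subbimoduleD(1))
  qed
qed

lemma product_ide_left:
  assumes "x \<in> Obj A" "y \<in> Obj A" "subbimodule A x y J"
  shows "bimodule_product A x y y (Hom A y y) J = J"
proof
  show "bimodule_product A x y y (Hom A y y) J \<subseteq> J"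
    using assms by (intro product_least) (auto simp: hom_subbimodule subbimoduleD)
  show "J \<subseteq> bimodule_product A x y y (Hom A y y) J"
  proof
    fix j assume "j \<in> J"
    then have "Comp A x y y (Ide A y) j \<in> bimodule_product A x y y (Hom A y y) J"
      using assms by (intro product_in) (auto simp: hom_subbimodule)
    then show "j \<in> bimodule_product A x y y (Hom A y y) J"
      using assms \<open>j \<in> J\<close> by (simp add: subbimoduleD(1))
  qed
qed

lemma product_assoc:
  assumes o: "w \<in> Obj A" "x \<in> Obj A" "y \<in> Obj A" "z \<in> Obj A"
    and J: "subbimodule A w x J" and K: "subbimodule A x y K" and L: "subbimodule A y z L"
  shows "bimodule_product A w x z (bimodule_product A x y z L K) J =
    bimodule_product A w y z L (bimodule_product A w x y K J)"
proof
  note KJ = product_subbimodule[OF o(1-3) J K] and LK = product_subbimodule[OF o(2-4) K L]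
  note L_KJ = product_subbimodule[OF o(1,3,4) KJ L] and LK_J = product_subbimodule[OF o(1,2,4) J LK]
  show "bimodule_product A w x z (bimodule_product A x y z L K) J \<subseteq>
    bimodule_product A w y z L (bimodule_product A w x y K J)"
  proof (rule product_least[OF o(1,2,4) J LK L_KJ])
    fix a j assume a: "a \<in> bimodule_product A x y z L K" and j: "j \<in> J"
    show "Comp A w x z a j \<in> bimodule_product A w y z L (bimodule_product A w x y K J)"
      using a
    proof (induction rule: product_induct[OF o(2-4) K L, consumes 1, case_names zero add])
      case zero
      then show ?case using o j by (simp add: subbimoduleD[OF L_KJ] subbimoduleD[OF J])
    next
      case (add l k b)
      have "Comp A w x z (Comp A x y z l k) j = Comp A w y z l (Comp A w x y k j)"
        using o add j by (simp add: comp_assoc subbimoduleD(1)[OF J] subbimoduleD(1)[OF K] subbimoduleD(1)[OF L])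
      also have "\<dots> \<in> bimodule_product A w y z L (bimodule_product A w x y K J)"
        by (intro product_in o KJ L J K add j)
      finally show ?case
        using o add j by (simp add: comp_add subbimoduleD(1)[OF J] subbimoduleD(1)[OF K] subbimoduleD(1)[OF L]
            subbimoduleD(1)[OF LK] subbimoduleD(3)[OF L_KJ])
    qed
  qed
  show "bimodule_product A w y z L (bimodule_product A w x y K J) \<subseteq>
    bimodule_product A w x z (bimodule_product A x y z L K) J"
  proof (rule product_least[OF o(1,3,4) KJ L LK_J])
    fix a l assume a: "a \<in> bimodule_product A w x y K J" and l: "l \<in> L"
    show "Comp A w y z l a \<in> bimodule_product A w x z (bimodule_product A x y z L K) J"
      using a
    proof (induction rule: product_induct[OF o(1-3) J K, consumes 1, case_names zero add])
      case zero
      then show ?case using o l by (simp add: subbimoduleD[OF LK_J] subbimoduleD[OF L])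
    next
      case (add k j b)
      have "Comp A w y z l (Comp A w x y k j) = Comp A w x z (Comp A x y z l k) j"
        using o add l by (simp add: comp_assoc subbimoduleD(1)[OF J] subbimoduleD(1)[OF K] subbimoduleD(1)[OF L])
      also have "\<dots> \<in> bimodule_product A w x z (bimodule_product A x y z L K) J"
        by (intro product_in o LK L J K add l)
      finally show ?case
        using o add l by (simp add: comp_add subbimoduleD(1)[OF J] subbimoduleD(1)[OF K] subbimoduleD(1)[OF L]
            subbimoduleD(1)[OF KJ] subbimoduleD(3)[OF LK_J])
    qed
  qed
qed

lemma product_zero:
  assumes "x \<in> Obj A" "y \<in> Obj A" "z \<in> Obj A"
  shows "subbimodule A x y J \<Longrightarrow> bimodule_product A x y z {0} J = {0}"
    and "subbimodule A y z K \<Longrightarrow> bimodule_product A x y z K {0} = {0}"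
proof -
  assume J: "subbimodule A x y J"
  have "bimodule_product A x y z {0} J \<subseteq> {0}"
    using assms J by (intro product_least) (auto simp: zero_subbimodule subbimoduleD(1)[OF J])
  then show "bimodule_product A x y z {0} J = {0}"
    using subbimoduleD(2)[OF product_subbimodule[OF assms J zero_subbimodule]] assms by auto
next
  assume K: "subbimodule A y z K"
  have "bimodule_product A x y z K {0} \<subseteq> {0}"
    using assms K by (intro product_least) (auto simp: zero_subbimodule subbimoduleD(1)[OF K])
  then show "bimodule_product A x y z K {0} = {0}"
    using subbimoduleD(2)[OF product_subbimodule[OF assms zero_subbimodule K]] assms by auto
qed

lemma stem_is_category: "is_category (stem_category A)"
  unfolding is_category_def stem_category_def
  by (auto simp: hom_subbimodule product_subbimodule product_ide_left product_ide_right product_assoc)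

end

section \<open>Locally bounded categories\<close>

locale lb_cat =
  fixes A :: "('k::field, 'o, 'm::ab_group_add) kcategory"
  assumes lb: "locally_bounded A"

sublocale lb_cat \<subseteq> lin_cat
  using lb by (unfold_locales) (simp add: locally_bounded_def)

context lb_cat
begin

section \<open>Units and the radical of a local endomorphism ring\<close>

lemma ide_nonzero: "x \<in> Obj A \<Longrightarrow> Ide A x \<noteq> 0"
  using lb by (simp add: locally_bounded_def local_endomorphisms_def)

lemma nonunit_add:
  "x \<in> Obj A \<Longrightarrow> a \<in> Hom A x x \<Longrightarrow> b \<in> Hom A x x \<Longrightarrow> \<not> invertible A x x a \<Longrightarrow> \<not> invertible A x x b \<Longrightarrow>
    \<not> invertible A x x (a + b)"
  using lb by (simp add: locally_bounded_def local_endomorphisms_def)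

lemma unit_ide [simp]: "x \<in> Obj A \<Longrightarrow> invertible A x x (Ide A x)"
  unfolding invertible_def by (auto intro!: bexI[of _ "Ide A x"])

lemma nonunit_zero [simp]: "x \<in> Obj A \<Longrightarrow> \<not> invertible A x x 0"
  using ide_nonzero by (auto simp: invertible_def)

text \<open>The idempotent \<open>f g\<close> of a local endomorphism ring is \<open>0\<close> or \<open>1\<close>.\<close>

lemma split_inverse:
  assumes o: "x \<in> Obj A" "y \<in> Obj A" and f: "f \<in> Hom A x y" and g: "g \<in> Hom A y x"
    and gf: "Comp A x y x g f = Ide A x"
  shows "Comp A y x y f g = Ide A y"
proof -
  define e where "e = Comp A y x y f g"
  have e: "e \<in> Hom A y y" using o f g by (simp add: e_def)
  have ef: "Comp A x y y e f = f"
    using o f g gf by (simp add: e_def comp_assoc)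
  have ee: "Comp A y y y e e = e"
    using o f g gf ef e by (simp add: e_def comp_assoc[symmetric])
  have "invertible A y y e \<or> invertible A y y (Ide A y - e)"
    using nonunit_add[of y e "Ide A y - e"] o e by auto
  then show ?thesis
  proof
    assume "invertible A y y e"
    then obtain h where h: "h \<in> Hom A y y" "Comp A y y y h e = Ide A y"
      by (auto simp: invertible_def)
    have "Comp A y y y h (Comp A y y y e e) = e"
      using o e h by (simp add: comp_assoc[symmetric])
    then show ?thesis using ee h by (simp add: e_def)
  next
    assume "invertible A y y (Ide A y - e)"
    then obtain h where h: "h \<in> Hom A y y" "Comp A y y y h (Ide A y - e) = Ide A y"
      by (auto simp: invertible_def)
    have "e = Comp A y y y (Comp A y y y h (Ide A y - e)) e"
      using o e h by simp
    also have "\<dots> = 0"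
      using o e h(1) ee by (simp add: comp_assoc comp_diff)
    finally have "f = 0" using ef o f by simp
    then show ?thesis using gf o g ide_nonzero[of x] by simp
  qed
qed

lemma split_invertible:
  assumes "x \<in> Obj A" "y \<in> Obj A" "f \<in> Hom A x y" "g \<in> Hom A y x" "Comp A x y x g f = Ide A x"
  shows "invertible A x y f" "invertible A y x g"
  using assms split_inverse[OF assms] by (auto simp: invertible_def)

text \<open>Locality makes the one-sided inverse two-sided, and distinct objects are not isomorphic.
  This excludes units among the morphisms between different objects of a fibre.\<close>

lemma split_obj_eq:
  assumes "x \<in> Obj A" "y \<in> Obj A" "f \<in> Hom A x y" "g \<in> Hom A y x" "Comp A x y x g f = Ide A x"
  shows "x = y"
  using split_invertible(1)[OF assms] lb assms(1,2) by (auto simp: locally_bounded_def isomorphic_def)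

text \<open>One-sided inverses are two-sided by locality, so both factors of a unit are units even
  without commutativity.\<close>

lemma unit_comp_iff:
  assumes x: "x \<in> Obj A" and a: "a \<in> Hom A x x" and b: "b \<in> Hom A x x"
  shows "invertible A x x (Comp A x x x a b) \<longleftrightarrow> invertible A x x a \<and> invertible A x x b"
proof
  assume "invertible A x x (Comp A x x x a b)"
  then obtain h where h: "h \<in> Hom A x x" "Comp A x x x h (Comp A x x x a b) = Ide A x"
    "Comp A x x x (Comp A x x x a b) h = Ide A x"
    by (auto simp: invertible_def)
  have "invertible A x x b"
    using x a b h by (intro split_invertible(1)[of x x b "Comp A x x x h a"]) (simp_all add: comp_assoc)
  moreover have "invertible A x x a"
    using x a b h by (intro split_invertible(2)[of x x "Comp A x x x b h" a]) (simp_all add: comp_assoc)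
  ultimately show "invertible A x x a \<and> invertible A x x b" by simp
next
  assume "invertible A x x a \<and> invertible A x x b"
  then obtain a' b' where h: "a' \<in> Hom A x x" "Comp A x x x a' a = Ide A x"
    "b' \<in> Hom A x x" "Comp A x x x b' b = Ide A x"
    by (auto simp: invertible_def)
  have "Comp A x x x (Comp A x x x b' a') (Comp A x x x a b) = Comp A x x x b' (Comp A x x x (Comp A x x x a' a) b)"
    using x a b h(1,3) by (simp add: comp_assoc)
  then show "invertible A x x (Comp A x x x a b)"
    using x a b h by (intro split_invertible(1)[of x x _ "Comp A x x x b' a'"]) simp_all
qed

lemma unit_scale:
  assumes "x \<in> Obj A" "c \<noteq> 0"
  shows "invertible A x x (Scale A c (Ide A x))"
  using assms by (intro split_invertible(1)[of x x _ "Scale A (inverse c) (Ide A x)"]) simp_all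

lemma nonunit_diff:
  assumes "x \<in> Obj A" "a \<in> Hom A x x" "b \<in> Hom A x x" "\<not> invertible A x x a" "\<not> invertible A x x b"
  shows "\<not> invertible A x x (a - b)"
proof -
  have "\<not> invertible A x x (Comp A x x x (Scale A (-1) (Ide A x)) b)"
    using assms by (subst unit_comp_iff) simp_all
  moreover have "Comp A x x x (Scale A (-1) (Ide A x)) b = - b"
    using assms by (subst comp_scale(2)) simp_all
  ultimately have "\<not> invertible A x x (- b)" by simp
  then show ?thesis using nonunit_add[of x a "- b"] assms by simp
qed

text \<open>If \<open>f\<close> has the inverse \<open>g\<close>, then \<open>1 - g f = 0\<close> is
  no unit. If \<open>f\<close> has none, then \<open>g f\<close> is no unit either, and as it adds
  up to \<open>1\<close> with \<open>1 - g f\<close>, the latter is one.\<close>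

lemma radical_iff:
  assumes x: "x \<in> Obj A"
  shows "f \<in> radical A x x \<longleftrightarrow> f \<in> Hom A x x \<and> \<not> invertible A x x f"
proof (intro iffI conjI)
  assume f: "f \<in> radical A x x"
  then show fin: "f \<in> Hom A x x" by (simp add: radical_def)
  show "\<not> invertible A x x f"
  proof
    assume "invertible A x x f"
    then obtain g where "g \<in> Hom A x x" "Comp A x x x g f = Ide A x" by (auto simp: invertible_def)
    then have "invertible A x x (Ide A x - Ide A x)" using f by (fastforce simp: radical_def)
    then show False using x by simp
  qed
next
  assume f: "f \<in> Hom A x x \<and> \<not> invertible A x x f"
  have "invertible A x x (Ide A x - Comp A x x x g f)" if g: "g \<in> Hom A x x" for g
    using nonunit_add[OF x, of "Comp A x x x g f" "Ide A x - Comp A x x x g f"] f g x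
    by (auto simp: unit_comp_iff)
  then show "f \<in> radical A x x" using f by (simp add: radical_def)
qed

lemma radical_subbimodule:
  assumes x: "x \<in> Obj A"
  shows "subbimodule A x x (radical A x x)"
proof -
  have "Scale A c f \<in> radical A x x" if f: "f \<in> radical A x x" for c f
  proof -
    have "\<not> invertible A x x (Comp A x x x (Scale A c (Ide A x)) f)"
      using f x by (subst unit_comp_iff) (simp_all add: radical_iff)
    then show ?thesis using f x by (simp add: radical_iff)
  qed
  then show ?thesis
    unfolding subbimodule_def vs.subspace_def using x
    by (auto simp: radical_iff nonunit_add unit_comp_iff)
qed

section \<open>Uniserial endomorphism rings\<close>

primrec endo_power :: "'o \<Rightarrow> 'm \<Rightarrow> nat \<Rightarrow> 'm" where
  "endo_power x t 0 = Ide A x"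
| "endo_power x t (Suc i) = Comp A x x x t (endo_power x t i)"

lemma endo_power_in [simp]: "x \<in> Obj A \<Longrightarrow> t \<in> Hom A x x \<Longrightarrow> endo_power x t i \<in> Hom A x x"
  by (induction i) auto

lemma endo_power_Suc_right:
  "x \<in> Obj A \<Longrightarrow> t \<in> Hom A x x \<Longrightarrow> endo_power x t (Suc i) = Comp A x x x (endo_power x t i) t"
  by (induction i) (simp_all add: comp_assoc[symmetric])

lemma nilpotent_nonunit:
  assumes x: "x \<in> Obj A" and t: "t \<in> Hom A x x" and "endo_power x t n = 0"
  shows "\<not> invertible A x x t"
proof
  assume "invertible A x x t"
  then have "invertible A x x (endo_power x t i)" for i
    using x t by (induction i) (simp_all add: unit_comp_iff)
  then show False using assms(3) x by (metis nonunit_zero)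
qed

text \<open>Evaluation at \<open>t\<close> by Horner's scheme, written out because composition on
  \<open>Hom A x x\<close> is an indexed operation on a set and not the multiplication of a ring
  type.\<close>

definition eval_poly :: "'o \<Rightarrow> 'm \<Rightarrow> 'k poly \<Rightarrow> 'm" where
  "eval_poly x t p = fold_coeffs (\<lambda>c a. Scale A c (Ide A x) + Comp A x x x t a) p 0"

context
  fixes x t
  assumes x: "x \<in> Obj A" and t: "t \<in> Hom A x x"
begin

lemma eval_poly_0 [simp]: "eval_poly x t 0 = 0"
  by (simp add: eval_poly_def)

lemma eval_poly_pCons [simp]:
  "eval_poly x t (pCons c p) = Scale A c (Ide A x) + Comp A x x x t (eval_poly x t p)"
  using x t by (cases "p = 0 \<and> c = 0") (auto simp: eval_poly_def fold_coeffs_pCons_eq)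

lemma eval_poly_in [simp]: "eval_poly x t p \<in> Hom A x x"
  using x t by (induction p) auto

lemma eval_poly_add: "eval_poly x t (p + q) = eval_poly x t p + eval_poly x t q"
proof (induction p q rule: poly_induct2)
  case (pCons a p b q)
  then show ?case using x t by (simp add: vs.scale_left_distrib comp_add)
qed simp

lemma eval_poly_smult: "eval_poly x t (smult c p) = Scale A c (eval_poly x t p)"
  using x t by (induction p) (simp_all add: vs.scale_right_distrib)

lemma eval_poly_mult: "eval_poly x t (p * q) = Comp A x x x (eval_poly x t p) (eval_poly x t q)"
proof (induction p)
  case (pCons c p)
  then show ?case
    using x t by (simp add: eval_poly_add eval_poly_smult comp_add comp_assoc)
qed (use x in simp)

lemma eval_poly_monom: "eval_poly x t (monom c i) = Scale A c (endo_power x t i)"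
  using x t by (induction i) (simp_all add: monom_0 monom_Suc)

lemma eval_poly_diff: "eval_poly x t (p - q) = eval_poly x t p - eval_poly x t q"
  using eval_poly_add[of "p - q" q] by (simp add: eq_diff_eq)

text \<open>Evaluation at \<open>t\<close> is onto, by repeated use of \<open>gen\<close>, and its
  kernel is generated by the power of \<open>T\<close> that is the exact nilpotency order of
  \<open>t\<close>. The condition \<open>gen\<close> is one-sided and commutativity is a result
  here, since only left multiples of a homogeneous element can be carried over to the other
  category.\<close>

lemma truncated_polynomialI:
  assumes nil: "endo_power x t n = 0"
    and gen: "\<And>a. a \<in> Hom A x x \<Longrightarrow> \<exists>c. \<exists>b\<in>Hom A x x. a = Scale A c (Ide A x) + Comp A x x x b t"
  shows "\<exists>n. endomorphisms_truncated_polynomial A x n"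
proof -
  \<comment> \<open>\<open>n\<close> is some exponent killing \<open>t\<close>; the kernel needs the
    least one.\<close>
  define d where "d = (LEAST n. endo_power x t n = 0)"
  have d: "endo_power x t d = 0" unfolding d_def using nil by (rule LeastI)
  have d_least: "endo_power x t m \<noteq> 0" if "m < d" for m
    using that not_less_Least unfolding d_def by blast
  have kernel: "eval_poly x t p = 0 \<longleftrightarrow> monom 1 d dvd p" for p
  proof
    assume "monom 1 d dvd p"
    then show "eval_poly x t p = 0"
      using x d by (auto simp: dvd_def eval_poly_mult eval_poly_monom)
  next
    assume p: "eval_poly x t p = 0"
    have "monom 1 m dvd p" if "m \<le> d" for m
      using that
    proof (induction m)
      case (Suc m)
      then obtain q where q: "p = monom 1 m * q" by (auto simp: dvd_def)
      obtain c r where cr: "q = pCons c r" by (rule pCons_cases)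
      have prod0: "Comp A x x x (endo_power x t m) (eval_poly x t q) = 0"
        using p q by (simp add: eval_poly_mult eval_poly_monom)
      \<comment> \<open>Otherwise \<open>q(t)\<close> is a nonzero scalar plus the non-unit
        \<open>t r(t)\<close>, hence a unit, and \<open>t^m = 0\<close> follows although
        \<open>m < d\<close>.\<close>
      have "c = 0"
      proof (rule ccontr)
        assume "c \<noteq> 0"
        then have "invertible A x x (eval_poly x t q - Comp A x x x t (eval_poly x t r))"
          using unit_scale[OF x] cr by simp
        then have "invertible A x x (eval_poly x t q)"
          using nonunit_diff[OF x, of "eval_poly x t q" "Comp A x x x t (eval_poly x t r)"]
            nilpotent_nonunit[OF x t nil] x t by (auto simp: unit_comp_iff)
        then obtain h where h: "h \<in> Hom A x x" "Comp A x x x (eval_poly x t q) h = Ide A x"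
          by (auto simp: invertible_def)
        have "endo_power x t m = Comp A x x x (Comp A x x x (endo_power x t m) (eval_poly x t q)) h"
          using x t h by (simp add: comp_assoc)
        then show False using prod0 x h d_least[of m] Suc.prems by simp
      qed
      then have "p = monom 1 (Suc m) * r"
        using q cr by (simp add: monom_Suc mult_pCons_left mult_pCons_right)
      then show ?case by (rule dvdI)
    qed (simp add: monom_0 flip: one_pCons)
    then show "monom 1 d dvd p" by simp
  qed
  have ev_eq: "eval_poly x t p = eval_poly x t q \<longleftrightarrow> (p, q) \<in> trunc_rel d" for p q
    using kernel[of "p - q"] by (simp add: trunc_rel_def eval_poly_diff)
  have equiv: "equiv UNIV (trunc_rel d :: ('k poly \<times> 'k poly) set)"
    unfolding equiv_def refl_on_def sym_def trans_def by (auto simp: ev_eq[symmetric])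
  \<comment> \<open>Each use of \<open>gen\<close> on the cofactor of \<open>t^i\<close> splits off
    one more coefficient; at \<open>i = d\<close> the remainder vanishes.\<close>
  have span: "\<exists>p. \<exists>b\<in>Hom A x x. a = eval_poly x t p + Comp A x x x b (endo_power x t i)"
    if "a \<in> Hom A x x" for a i
  proof (induction i)
    case 0
    show ?case using x that by (intro exI[of _ 0] bexI[of _ a]) simp_all
  next
    case (Suc i)
    then obtain p b where pb: "b \<in> Hom A x x" "a = eval_poly x t p + Comp A x x x b (endo_power x t i)"
      by blast
    obtain c b' where b': "b' \<in> Hom A x x" "b = Scale A c (Ide A x) + Comp A x x x b' t"
      using gen[OF pb(1)] by blast
    have "a = eval_poly x t (p + monom c i) + Comp A x x x b' (endo_power x t (Suc i))"
      using x t pb b' by (simp add: eval_poly_add eval_poly_monom comp_add comp_assoc)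
    then show ?case using b'(1) by blast
  qed
  have surj: "\<exists>p. a = eval_poly x t p" if a: "a \<in> Hom A x x" for a
  proof -
    obtain p b where "b \<in> Hom A x x" "a = eval_poly x t p + Comp A x x x b (endo_power x t d)"
      using span[OF a, of d] by blast
    then show ?thesis using x d by auto
  qed
  \<comment> \<open>An arbitrary representative is evaluated; \<open>ev_eq\<close> makes the value
    independent of it.\<close>
  define \<phi> where "\<phi> S = eval_poly x t (SOME p. p \<in> S)" for S
  have \<phi>: "\<phi> (trunc_class d p) = eval_poly x t p" for p
  proof -
    have "p \<in> trunc_class d p" using equiv by (simp add: trunc_class_def trunc_rel_def)
    then have "(SOME q. q \<in> trunc_class d p) \<in> trunc_class d p" by (rule someI)
    then show ?thesis
      unfolding \<phi>_def by (simp add: trunc_class_def ev_eq[symmetric])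
  qed
  have quot: "UNIV // trunc_rel d = range (trunc_class d :: 'k poly \<Rightarrow> _)"
    by (auto simp: quotient_def trunc_class_def)
  have class_eq: "trunc_class d p = trunc_class d q \<longleftrightarrow> eval_poly x t p = eval_poly x t q" for p q
    using equiv by (simp add: trunc_class_def ev_eq eq_equiv_class_iff)
  have "bij_betw \<phi> (UNIV // trunc_rel d) (Hom A x x)"
    unfolding bij_betw_def inj_on_def quot using surj
    by (auto simp: \<phi> class_eq image_image)
  then have "endomorphisms_truncated_polynomial A x d"
    unfolding endomorphisms_truncated_polynomial_def using x t
    by (intro exI[of _ \<phi>]) (simp add: \<phi> eval_poly_add eval_poly_mult eval_poly_smult one_pCons)
  then show ?thesis ..
qed

end

text \<open>What is retained of an isomorphism with \<open>k[T]/(T^n)\<close>: \<open>t\<close> is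
  the image of \<open>T\<close>. The exponent \<open>n\<close> need not be exact. The name refers to
  the chain of ideals generated by the powers of \<open>t\<close>.\<close>

definition uniserial :: "'o \<Rightarrow> 'm \<Rightarrow> nat \<Rightarrow> bool" where
  "uniserial x t n \<longleftrightarrow> t \<in> Hom A x x \<and> endo_power x t n = 0 \<and>
     (\<forall>a\<in>Hom A x x. \<forall>b\<in>Hom A x x. Comp A x x x a b = Comp A x x x b a) \<and>
     (\<forall>a\<in>Hom A x x. \<exists>c. \<exists>b\<in>Hom A x x. a = Scale A c (Ide A x) + Comp A x x x t b)"

lemma truncated_polynomial_uniserial:
  assumes x: "x \<in> Obj A" and "endomorphisms_truncated_polynomial A x n"
  shows "\<exists>t. uniserial x t n"
proof -
  obtain \<phi> where bij: "bij_betw \<phi> (UNIV // trunc_rel n) (Hom A x x)"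
    and one: "\<phi> (trunc_class n 1) = Ide A x"
    and add: "\<And>p q. \<phi> (trunc_class n (p + q)) = \<phi> (trunc_class n p) + \<phi> (trunc_class n q)"
    and mult: "\<And>p q. \<phi> (trunc_class n (p * q)) =
                 Comp A x x x (\<phi> (trunc_class n p)) (\<phi> (trunc_class n q))"
    and smult: "\<And>c p. \<phi> (trunc_class n (smult c p)) = Scale A c (\<phi> (trunc_class n p))"
    using assms(2) unfolding endomorphisms_truncated_polynomial_def by auto
  define \<psi> where "\<psi> p = \<phi> (trunc_class n p)" for p
  have range: "Hom A x x = range \<psi>"
    using bij unfolding bij_betw_def \<psi>_def by (auto simp: quotient_def trunc_class_def image_iff)
  then have in_hom [simp]: "\<psi> p \<in> Hom A x x" for p by auto
  define t where "t = \<psi> [:0, 1:]"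
  have pw: "endo_power x t i = \<psi> (monom 1 i)" for i
    by (induction i)
      (simp_all add: monom_0 monom_Suc t_def \<psi>_def one mult[symmetric] flip: one_pCons)
  have "trunc_class n (monom 1 n) = (trunc_class n 0 :: 'k poly set)"
  proof -
    have "monom 1 n dvd monom 1 n - p \<longleftrightarrow> monom 1 n dvd 0 - p" for p :: "'k poly"
      by (metis diff_0 dvd_diff_right_iff dvd_minus_iff dvd_refl)
    then show ?thesis by (auto simp: trunc_class_def trunc_rel_def)
  qed
  moreover have "\<psi> 0 = 0" using smult[of 0 0] by (simp add: \<psi>_def)
  ultimately have nil: "endo_power x t n = 0" unfolding pw by (simp add: \<psi>_def)
  have comm: "Comp A x x x a b = Comp A x x x b a" if "a \<in> Hom A x x" "b \<in> Hom A x x" for a b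
    using that range mult by (auto simp: \<psi>_def mult.commute simp flip: mult)
  have "\<exists>c. \<exists>b\<in>Hom A x x. a = Scale A c (Ide A x) + Comp A x x x t b" if a: "a \<in> Hom A x x" for a
  proof -
    obtain p where p: "a = \<psi> p" using a range by blast
    obtain c q where cq: "p = pCons c q" by (rule pCons_cases)
    have "p = smult c 1 + [:0, 1:] * q" by (simp add: cq)
    then have "a = Scale A c (Ide A x) + Comp A x x x t (\<psi> q)"
      unfolding p t_def \<psi>_def by (simp only: add smult mult one)
    then show ?thesis using in_hom by blast
  qed
  then show ?thesis
    unfolding uniserial_def using nil comm by (auto intro!: exI[of _ t] simp: t_def)
qed

context
  fixes x t n
  assumes x: "x \<in> Obj A" and us: "uniserial x t n"
begin

lemma uniserialD:
  "t \<in> Hom A x x" "endo_power x t n = 0"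
  "a \<in> Hom A x x \<Longrightarrow> b \<in> Hom A x x \<Longrightarrow> Comp A x x x a b = Comp A x x x b a"
  "a \<in> Hom A x x \<Longrightarrow> \<exists>c. \<exists>b\<in>Hom A x x. a = Scale A c (Ide A x) + Comp A x x x t b"
  using us by (auto simp: uniserial_def)

text \<open>In \<open>a = c + t b\<close> the part \<open>t b\<close> is no unit because
  \<open>t\<close> is nilpotent. So if \<open>a\<close> is no unit, then neither is the scalar
  \<open>c = a - t b\<close>, which must be \<open>0\<close>.\<close>

lemma uniserial_radical: "radical A x x = (\<lambda>b. Comp A x x x t b) ` Hom A x x"
proof (intro equalityI subsetI)
  fix a assume "a \<in> radical A x x"
  then have a: "a \<in> Hom A x x" "\<not> invertible A x x a" using x by (simp_all add: radical_iff)
  obtain c b where cb: "b \<in> Hom A x x" "a = Scale A c (Ide A x) + Comp A x x x t b"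
    using uniserialD(4)[OF a(1)] by blast
  have "\<not> invertible A x x (Comp A x x x t b)"
    using nilpotent_nonunit[OF x uniserialD(1,2)] uniserialD(1) x cb by (simp add: unit_comp_iff)
  then have "\<not> invertible A x x (a - Comp A x x x t b)"
    using x a cb(1) uniserialD(1) by (intro nonunit_diff) simp_all
  then have "c = 0" using unit_scale[OF x, of c] cb(2) by auto
  then show "a \<in> (\<lambda>b. Comp A x x x t b) ` Hom A x x" using cb by simp
next
  fix a assume "a \<in> (\<lambda>b. Comp A x x x t b) ` Hom A x x"
  then show "a \<in> radical A x x"
    using nilpotent_nonunit[OF x uniserialD(1,2)] uniserialD(1) x by (auto simp: radical_iff unit_comp_iff)
qed

text \<open>By \<open>uniserial_radical\<close> a factor \<open>t\<close> splits off as long as the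
  cofactor is no unit. This is the valuation of \<open>a\<close> with respect to \<open>t\<close>,
  cut off at \<open>i\<close>.\<close>

lemma uniserial_cases:
  assumes a: "a \<in> Hom A x x"
  shows "(\<exists>b\<in>Hom A x x. a = Comp A x x x (endo_power x t i) b) \<or>
    (\<exists>m<i. \<exists>u. invertible A x x u \<and> a = Comp A x x x (endo_power x t m) u)"
proof (induction i)
  case 0
  then show ?case using x a by (auto intro!: bexI[of _ a])
next
  case (Suc i)
  show ?case
  proof (cases "\<exists>m<i. \<exists>u. invertible A x x u \<and> a = Comp A x x x (endo_power x t m) u")
    case True
    then show ?thesis using less_SucI by blast
  next
    case False
    then obtain b where b: "b \<in> Hom A x x" "a = Comp A x x x (endo_power x t i) b"
      using Suc by blast
    show ?thesis
    proof (cases "invertible A x x b")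
      case True
      then show ?thesis using b by blast
    next
      case False
      then have "b \<in> radical A x x" using x b by (simp add: radical_iff)
      then obtain b' where b': "b' \<in> Hom A x x" "b = Comp A x x x t b'"
        using uniserial_radical by blast
      have "a = Comp A x x x (endo_power x t (Suc i)) b'"
        using x b b' uniserialD(1) endo_power_Suc_right[of x t i] by (simp add: comp_assoc del: endo_power.simps)
      then show ?thesis using b' by blast
    qed
  qed
qed

text \<open>A generator \<open>k r\<close> with \<open>r = t b\<close> equals \<open>(k b) t\<close>
  by commutativity, and \<open>k b\<close> stays in \<open>J\<close>. Sums therefore collapse to a
  single multiple of \<open>t\<close>.\<close>

lemma product_radical_right:
  assumes y: "y \<in> Obj A" and J: "subbimodule A x y J"
    and a: "a \<in> bimodule_product A x x y J (radical A x x)"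
  shows "\<exists>j\<in>J. a = Comp A x x y j t"
  using a
proof (induction rule: product_induct[OF x x y radical_subbimodule[OF x] J, consumes 1, case_names zero add])
  case zero
  then show ?case using x y uniserialD(1) by (intro bexI[of _ 0]) (simp_all add: subbimoduleD[OF J])
next
  case (add k r a)
  then obtain b j where b: "b \<in> Hom A x x" "r = Comp A x x x t b" and j: "j \<in> J" "a = Comp A x x y j t"
    by (auto simp: uniserial_radical)
  have "r = Comp A x x x b t" using b uniserialD(1,3) by simp
  then have "Comp A x x y k r + a = Comp A x x y (Comp A x x y k b + j) t"
    using x y b j uniserialD(1) add(1) by (simp add: comp_add comp_assoc subbimoduleD(1)[OF J])
  moreover have "Comp A x x y k b + j \<in> J"
    using subbimoduleD[OF J] b j add(1) by simp
  ultimately show ?case by blast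
qed

lemma product_radical_left:
  assumes w: "w \<in> Obj A" and J: "subbimodule A w x J"
    and a: "a \<in> bimodule_product A w x x (radical A x x) J"
  shows "\<exists>j\<in>J. a = Comp A w x x t j"
  using a
proof (induction rule: product_induct[OF w x x J radical_subbimodule[OF x], consumes 1, case_names zero add])
  case zero
  then show ?case using x w uniserialD(1) by (intro bexI[of _ 0]) (simp_all add: subbimoduleD[OF J])
next
  case (add r k a)
  then obtain b j where b: "b \<in> Hom A x x" "r = Comp A x x x t b" and j: "j \<in> J" "a = Comp A w x x t j"
    by (auto simp: uniserial_radical)
  have "Comp A w x x r k + a = Comp A w x x t (Comp A w x x b k + j)"
    using x w b j uniserialD(1) add(2) by (simp add: comp_add comp_assoc subbimoduleD(1)[OF J])
  moreover have "Comp A w x x b k + j \<in> J"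
    using subbimoduleD[OF J] b j add(2) by simp
  ultimately show ?case by blast
qed

text \<open>No finiteness of \<open>J\<close> is involved: iterating \<open>J = J t\<close> gives
  \<open>J = J t^n\<close>, and \<open>t^n = 0\<close>.\<close>

lemma nakayama_right:
  assumes y: "y \<in> Obj A" and J: "subbimodule A x y J"
    and eq: "bimodule_product A x x y J (radical A x x) = J"
  shows "J = {0}"
proof -
  have "\<exists>j'\<in>J. j = Comp A x x y j' (endo_power x t i)" if j: "j \<in> J" for j i
  proof (induction i)
    case 0
    then show ?case using x y j by (intro bexI[of _ j]) (simp_all add: subbimoduleD(1)[OF J])
  next
    case (Suc i)
    then obtain j' where j': "j' \<in> J" "j = Comp A x x y j' (endo_power x t i)" by blast
    then obtain j'' where j'': "j'' \<in> J" "j' = Comp A x x y j'' t"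
      using product_radical_right[OF y J] eq by blast
    then have "j = Comp A x x y j'' (endo_power x t (Suc i))"
      using j' x y uniserialD(1) by (simp add: comp_assoc subbimoduleD(1)[OF J])
    then show ?case using j'' by blast
  qed
  from this[of _ n] have "J \<subseteq> {0}"
    using x y uniserialD(2) by (fastforce simp: subbimoduleD(1)[OF J])
  then show ?thesis using subbimoduleD(2)[OF J] by blast
qed

lemma nakayama_left:
  assumes w: "w \<in> Obj A" and J: "subbimodule A w x J"
    and eq: "bimodule_product A w x x (radical A x x) J = J"
  shows "J = {0}"
proof -
  have "\<exists>j'\<in>J. j = Comp A w x x (endo_power x t i) j'" if j: "j \<in> J" for j i
  proof (induction i)
    case 0
    then show ?case using x w j by (intro bexI[of _ j]) (simp_all add: subbimoduleD(1)[OF J])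
  next
    case (Suc i)
    then obtain j' where j': "j' \<in> J" "j = Comp A w x x (endo_power x t i) j'" by blast
    then obtain j'' where j'': "j'' \<in> J" "j' = Comp A w x x t j''"
      using product_radical_left[OF w J] eq by blast
    then have "j = Comp A w x x (endo_power x t (Suc i)) j''"
      using j' x w uniserialD(1) endo_power_Suc_right[of x t i]
      by (simp add: comp_assoc subbimoduleD(1)[OF J] del: endo_power.simps)
    then show ?case using j'' by blast
  qed
  from this[of _ n] have "J \<subseteq> {0}"
    using x w uniserialD(2) by (fastforce simp: subbimoduleD(1)[OF J])
  then show ?thesis using subbimoduleD(2)[OF J] by blast
qed

text \<open>\<open>i\<close> is the least exponent with \<open>f t^i\<close> in \<open>J\<close>; it
  exists because \<open>f t^n = 0\<close>. An element \<open>f t^m u\<close> of \<open>J\<close>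
  with a unit \<open>u\<close> and \<open>m < i\<close> would put \<open>f t^m\<close> into
  \<open>J\<close>.\<close>

lemma subbimodule_cyclic_right:
  assumes y: "y \<in> Obj A" and f: "f \<in> Hom A x y" "Hom A x y = (\<lambda>a. Comp A x x y f a) ` Hom A x x"
    and J: "subbimodule A x y J"
  shows "\<exists>i. J = (\<lambda>a. Comp A x x y (Comp A x x y f (endo_power x t i)) a) ` Hom A x x"
proof -
  define i where "i = (LEAST i. Comp A x x y f (endo_power x t i) \<in> J)"
  have "Comp A x x y f (endo_power x t n) \<in> J"
    using x y f by (simp add: uniserialD(2) subbimoduleD(2)[OF J])
  then have i: "Comp A x x y f (endo_power x t i) \<in> J" unfolding i_def by (rule LeastI)
  have least: "Comp A x x y f (endo_power x t m) \<notin> J" if "m < i" for m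
    using that not_less_Least unfolding i_def by blast
  have "J \<subseteq> (\<lambda>a. Comp A x x y (Comp A x x y f (endo_power x t i)) a) ` Hom A x x"
  proof
    fix j assume j: "j \<in> J"
    then obtain a where a: "a \<in> Hom A x x" "j = Comp A x x y f a"
      using subbimoduleD(1)[OF J j] f by blast
    have False if u: "m < i" "invertible A x x u" "a = Comp A x x x (endo_power x t m) u" for m u
    proof -
      obtain v where v: "v \<in> Hom A x x" "Comp A x x x u v = Ide A x" "u \<in> Hom A x x"
        using u(2) by (auto simp: invertible_def)
      have "Comp A x x y j v = Comp A x x y f (endo_power x t m)"
        using x y a(2) v f u(3) uniserialD(1) by (simp add: comp_assoc)
      then show False using subbimoduleD(6)[OF J j v(1)] least[OF u(1)] by simp
    qed
    then obtain b where "b \<in> Hom A x x" "a = Comp A x x x (endo_power x t i) b"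
      using uniserial_cases[OF a(1), of i] by blast
    then show "j \<in> (\<lambda>a. Comp A x x y (Comp A x x y f (endo_power x t i)) a) ` Hom A x x"
      using x y f a uniserialD(1) by (auto simp: comp_assoc)
  qed
  then show ?thesis using i subbimoduleD(6)[OF J] by blast
qed

text \<open>As on the right, except that the unit \<open>u\<close> has to be moved past the power of
  \<open>t\<close>, which commutativity of the endomorphism ring allows.\<close>

lemma subbimodule_cyclic_left:
  assumes w: "w \<in> Obj A" and f: "f \<in> Hom A w x" "Hom A w x = (\<lambda>b. Comp A w x x b f) ` Hom A x x"
    and J: "subbimodule A w x J"
  shows "\<exists>i. J = (\<lambda>b. Comp A w x x b (Comp A w x x (endo_power x t i) f)) ` Hom A x x"
proof -
  define i where "i = (LEAST i. Comp A w x x (endo_power x t i) f \<in> J)"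
  have "Comp A w x x (endo_power x t n) f \<in> J"
    using x w f by (simp add: uniserialD(2) subbimoduleD(2)[OF J])
  then have i: "Comp A w x x (endo_power x t i) f \<in> J" unfolding i_def by (rule LeastI)
  have least: "Comp A w x x (endo_power x t m) f \<notin> J" if "m < i" for m
    using that not_less_Least unfolding i_def by blast
  have "J \<subseteq> (\<lambda>b. Comp A w x x b (Comp A w x x (endo_power x t i) f)) ` Hom A x x"
  proof
    fix j assume j: "j \<in> J"
    then obtain a where a: "a \<in> Hom A x x" "j = Comp A w x x a f"
      using subbimoduleD(1)[OF J j] f by blast
    have False if u: "m < i" "invertible A x x u" "a = Comp A x x x (endo_power x t m) u" for m u
    proof -
      obtain v where v: "v \<in> Hom A x x" "Comp A x x x v u = Ide A x" "u \<in> Hom A x x"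
        using u(2) by (auto simp: invertible_def)
      have "a = Comp A x x x u (endo_power x t m)"
        using u(3) v(3) x uniserialD(1,3) by simp
      then have "Comp A w x x v j = Comp A w x x (endo_power x t m) f"
        using x w a(2) v f uniserialD(1) by (simp add: comp_assoc[symmetric])
      then show False using subbimoduleD(7)[OF J j v(1)] least[OF u(1)] by simp
    qed
    then obtain b where b: "b \<in> Hom A x x" "a = Comp A x x x (endo_power x t i) b"
      using uniserial_cases[OF a(1), of i] by blast
    then have "a = Comp A x x x b (endo_power x t i)"
      using x uniserialD(1,3) by simp
    then show "j \<in> (\<lambda>b. Comp A w x x b (Comp A w x x (endo_power x t i) f)) ` Hom A x x"
      using x w f a b(1) uniserialD(1) by (auto simp: comp_assoc)
  qed
  then show ?thesis using i subbimoduleD(7)[OF J] by blast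
qed

end

end

section \<open>Ray categories of distributive categories\<close>

locale dist_cat = lb_cat +
  assumes dist: "distributive A"
begin

lemma obtain_uniserial:
  assumes "x \<in> Obj A"
  obtains t n where "uniserial x t n"
  using assms dist truncated_polynomial_uniserial[OF assms] unfolding distributive_def by metis

text \<open>\<open>J\<close> is generated by one element \<open>g\<close> over one of the two rings.
  If an element of \<open>I\<close> had a unit as its coefficient, then \<open>g\<close>, and with
  it \<open>J\<close>, would lie in \<open>I\<close>; so all coefficients are radical. This drives
  the associativity of the ray product.\<close>

lemma proper_subbimodule:
  assumes o: "x \<in> Obj A" "y \<in> Obj A" and I: "subbimodule A x y I" and J: "subbimodule A x y J"
    and sub: "I \<subseteq> J" "I \<noteq> J"
  shows "I \<subseteq> bimodule_product A x x y J (radical A x x) \<or> I \<subseteq> bimodule_product A x y y (radical A y y) J"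
proof -
  note hom = subbimoduleD(1)[OF I] subbimoduleD(1)[OF J]
  consider "cyclic_right A x y" | "cyclic_left A x y"
    using dist o unfolding distributive_def by blast
  then show ?thesis
  proof cases
    case 1
    then obtain f where f: "f \<in> Hom A x y" "Hom A x y = (\<lambda>a. Comp A x x y f a) ` Hom A x x"
      unfolding cyclic_right_def by blast
    obtain t n where us: "uniserial x t n" using obtain_uniserial[OF o(1)] .
    note t = uniserialD(1)[OF o(1) us]
    obtain i where "J = (\<lambda>a. Comp A x x y (Comp A x x y f (endo_power x t i)) a) ` Hom A x x"
      using subbimodule_cyclic_right[OF o(1) us o(2) f J] by blast
    then obtain g where g: "g \<in> Hom A x y" "J = (\<lambda>a. Comp A x x y g a) ` Hom A x x"
      using f(1) o t by (metis comp_in endo_power_in)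
    have gJ: "g \<in> J" unfolding g(2) using o g(1) by (auto intro!: image_eqI[of _ _ "Ide A x"])
    have "v \<in> bimodule_product A x x y J (radical A x x)" if v: "v \<in> I" for v
    proof -
      obtain a where a: "a \<in> Hom A x x" "v = Comp A x x y g a"
        using v sub(1) g(2) by blast
      have "\<not> invertible A x x a"
      proof
        assume "invertible A x x a"
        then obtain b where b: "b \<in> Hom A x x" "Comp A x x x a b = Ide A x"
          by (auto simp: invertible_def)
        have "Comp A x x y v b = g" using a b o g(1) by (simp add: comp_assoc)
        then have "g \<in> I" using subbimoduleD(6)[OF I v b(1)] by simp
        then have "J \<subseteq> I" unfolding g(2) using subbimoduleD(6)[OF I] by blast
        then show False using sub by simp
      qed
      then have "a \<in> radical A x x" using a o by (simp add: radical_iff)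
      then show ?thesis
        unfolding a(2) by (intro product_in o J radical_subbimodule gJ)
    qed
    then show ?thesis by blast
  next
    case 2
    then obtain f where f: "f \<in> Hom A x y" "Hom A x y = (\<lambda>b. Comp A x y y b f) ` Hom A y y"
      unfolding cyclic_left_def by blast
    obtain t n where us: "uniserial y t n" using obtain_uniserial[OF o(2)] .
    note t = uniserialD(1)[OF o(2) us]
    obtain i where "J = (\<lambda>b. Comp A x y y b (Comp A x y y (endo_power y t i) f)) ` Hom A y y"
      using subbimodule_cyclic_left[OF o(2) us o(1) f J] by blast
    then obtain g where g: "g \<in> Hom A x y" "J = (\<lambda>b. Comp A x y y b g) ` Hom A y y"
      using f(1) o t by (metis comp_in endo_power_in)
    have gJ: "g \<in> J" unfolding g(2) using o g(1) by (auto intro!: image_eqI[of _ _ "Ide A y"])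
    have "v \<in> bimodule_product A x y y (radical A y y) J" if v: "v \<in> I" for v
    proof -
      obtain a where a: "a \<in> Hom A y y" "v = Comp A x y y a g"
        using v sub(1) g(2) by blast
      have "\<not> invertible A y y a"
      proof
        assume "invertible A y y a"
        then obtain b where b: "b \<in> Hom A y y" "Comp A y y y b a = Ide A y"
          by (auto simp: invertible_def)
        have "Comp A x y y b v = g" using a b o g(1) by (simp add: comp_assoc[symmetric])
        then have "g \<in> I" using subbimoduleD(7)[OF I v b(1)] by simp
        then have "J \<subseteq> I" unfolding g(2) using subbimoduleD(7)[OF I] by blast
        then show False using sub by simp
      qed
      then have "a \<in> radical A y y" using a o by (simp add: radical_iff)
      then show ?thesis
        unfolding a(2) by (intro product_in o J radical_subbimodule gJ)
    qed
    then show ?thesis by blast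
  qed
qed

lemma nakayama:
  assumes "x \<in> Obj A" "y \<in> Obj A" "subbimodule A x y J"
  shows "bimodule_product A x x y J (radical A x x) = J \<Longrightarrow> J = {0}"
    and "bimodule_product A x y y (radical A y y) J = J \<Longrightarrow> J = {0}"
  using assms obtain_uniserial nakayama_right nakayama_left by metis+

lemma product_radical_subset:
  assumes "x \<in> Obj A" "y \<in> Obj A" "subbimodule A x y J"
  shows "bimodule_product A x x y J (radical A x x) \<subseteq> J" "bimodule_product A x y y (radical A y y) J \<subseteq> J"
proof -
  show "bimodule_product A x x y J (radical A x x) \<subseteq> J"
    using assms by (intro product_least radical_subbimodule) (simp_all add: radical_iff subbimoduleD)
  show "bimodule_product A x y y (radical A y y) J \<subseteq> J"
    using assms by (intro product_least radical_subbimodule) (simp_all add: radical_iff subbimoduleD)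
qed

section \<open>The ray product is unital and associative\<close>

lemma ray_product_eq:
  "ray_product A x y z K J =
    (if bimodule_product A x y z (bimodule_product A y y z K (radical A y y)) J = bimodule_product A x y z K J
     then {0} else bimodule_product A x y z K J)"
  by (simp add: ray_product_def)

lemma ray_product_subbimodule:
  assumes "x \<in> Obj A" "y \<in> Obj A" "z \<in> Obj A" "subbimodule A x y J" "subbimodule A y z K"
  shows "subbimodule A x z (ray_product A x y z K J)"
  using assms by (simp add: ray_product_eq product_subbimodule zero_subbimodule)

text \<open>Annihilation would mean that \<open>J\<close> equals its product with the radical on one
  side. Then \<open>J = {0}\<close> by Nakayama, and both sides agree again.\<close>

lemma ray_product_ide:
  assumes "x \<in> Obj A" "y \<in> Obj A" "subbimodule A x y J"
  shows "ray_product A x x y J (Hom A x x) = J" "ray_product A x y y (Hom A y y) J = J"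
  using nakayama[OF assms] assms
  by (auto simp: ray_product_eq product_ide_left product_ide_right product_assoc hom_subbimodule
      radical_subbimodule product_subbimodule)

lemma ray_product_zero:
  assumes "x \<in> Obj A" "y \<in> Obj A" "z \<in> Obj A"
  shows "subbimodule A x y J \<Longrightarrow> ray_product A x y z {0} J = {0}"
    and "subbimodule A y z K \<Longrightarrow> ray_product A x y z K {0} = {0}"
  using assms by (auto simp: ray_product_def product_zero)

text \<open>Let \<open>T\<close> be the product of all three and suppose that inserting the radical
  at \<open>y\<close> does not change \<open>T\<close>, although it makes the product of
  \<open>L\<close> and \<open>K\<close> smaller. By \<open>proper_subbimodule\<close> the smaller
  one lies in the product of \<open>L\<close> and \<open>K\<close> with the radical at
  \<open>x\<close> or at \<open>z\<close>. Multiplying by \<open>J\<close>, in the first case the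
  radical at \<open>x\<close> does not change \<open>T\<close> either; in the second
  \<open>T\<close> lies in its product with the radical at \<open>z\<close>, so
  \<open>T = {0}\<close> by Nakayama. The other bracketing is symmetric.\<close>

lemma ray_product_assoc:
  assumes o: "w \<in> Obj A" "x \<in> Obj A" "y \<in> Obj A" "z \<in> Obj A"
    and J: "subbimodule A w x J" and K: "subbimodule A x y K" and L: "subbimodule A y z L"
  shows "ray_product A w x z (ray_product A x y z L K) J = ray_product A w y z L (ray_product A w x y K J)"
proof -
  let ?B = "bimodule_product A" and ?N = "\<lambda>x. radical A x x"
  note R = radical_subbimodule
  note KJ = product_subbimodule[OF o(1-3) J K] and LK = product_subbimodule[OF o(2-4) K L]
  note KN = product_subbimodule[OF o(2,2,3) R[OF o(2)] K] and LN = product_subbimodule[OF o(3,3,4) R[OF o(3)] L]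
  note NJ = product_subbimodule[OF o(1,2,2) J R[OF o(2)]] and NK = product_subbimodule[OF o(2,3,3) K R[OF o(3)]]
  note NKJ = product_subbimodule[OF o(1,3,3) KJ R[OF o(3)]]
  define T where "T = ?B w y z L (?B w x y K J)"
  have T: "subbimodule A w z T" unfolding T_def by (intro product_subbimodule o KJ L)
  have LK_J: "?B w x z (?B x y z L K) J = T" unfolding T_def by (rule product_assoc[OF o J K L])
  \<comment> \<open>\<open>P\<close> and \<open>Q\<close> are the annihilation conditions of the
    inner products, \<open>P'\<close> and \<open>Q'\<close> those of the outer products.\<close>
  define P where "P \<longleftrightarrow> ?B w x y (?B x x y K (?N x)) J = ?B w x y K J"
  define Q where "Q \<longleftrightarrow> ?B x y z (?B y y z L (?N y)) K = ?B x y z L K"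
  define P' where "P' \<longleftrightarrow> ?B w x z (?B x x z (?B x y z L K) (?N x)) J = T"
  define Q' where "Q' \<longleftrightarrow> ?B w y z (?B y y z L (?N y)) (?B w x y K J) = T"
  have P1: "?B w x z (?B x x z (?B x y z L K) (?N x)) J = ?B w y z L (?B w x y (?B x x y K (?N x)) J)"
    unfolding product_assoc[OF o(2,2,3,4) R[OF o(2)] K L] by (rule product_assoc[OF o J KN L])
  have Q1: "?B w y z (?B y y z L (?N y)) (?B w x y K J) = ?B w x z (?B x y z (?B y y z L (?N y)) K) J"
    by (rule product_assoc[OF o J K LN, symmetric])
  have PP': "P \<Longrightarrow> P'" unfolding P_def P'_def P1 T_def by simp
  have QQ': "Q \<Longrightarrow> Q'" unfolding Q_def Q'_def Q1 using LK_J by simp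
  have le_P: "X \<subseteq> T" if "X = ?B w y z L (?B w x y (?B x x y K (?N x)) J)" for X
  proof -
    have "?B w x y (?B x x y K (?N x)) J \<subseteq> ?B w x y K J"
      by (intro product_mono product_radical_subset o K subset_refl)
    then show ?thesis unfolding that T_def by (rule product_mono[OF subset_refl])
  qed
  have le_Q: "X \<subseteq> T" if "X = ?B w x z (?B x y z (?B y y z L (?N y)) K) J" for X
  proof -
    have "?B x y z (?B y y z L (?N y)) K \<subseteq> ?B x y z L K"
      by (intro product_mono product_radical_subset o L subset_refl)
    then show ?thesis unfolding that LK_J[symmetric] by (rule product_mono[OF _ subset_refl])
  qed
  have zeroR: "T = {0}" if "T \<subseteq> ?B w w z T (?N w)"
    using that nakayama(1)[OF o(1,4) T] product_radical_subset(1)[OF o(1,4) T] by blast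
  have zeroL: "T = {0}" if "T \<subseteq> ?B w z z (?N z) T"
    using that nakayama(2)[OF o(1,4) T] product_radical_subset(2)[OF o(1,4) T] by blast
  have Q'P': "P' \<or> T = {0}" if Q: "\<not> Q" and Q': Q'
  proof -
    have sub: "subbimodule A x z (?B x y z (?B y y z L (?N y)) K)"
      by (intro product_subbimodule o LN K)
    have "?B x y z (?B y y z L (?N y)) K \<subseteq> ?B x y z L K"
      by (intro product_mono product_radical_subset o L subset_refl)
    with proper_subbimodule[OF o(2,4) sub LK] Q
    consider "?B x y z (?B y y z L (?N y)) K \<subseteq> ?B x x z (?B x y z L K) (?N x)"
      | "?B x y z (?B y y z L (?N y)) K \<subseteq> ?B x z z (?N z) (?B x y z L K)"
      unfolding Q_def by blast
    then show ?thesis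
    proof cases
      case 1
      then have "T \<subseteq> ?B w x z (?B x x z (?B x y z L K) (?N x)) J"
        using Q' unfolding Q'_def Q1 by (metis product_mono subset_refl)
      then show ?thesis using le_P[OF P1] unfolding P'_def by blast
    next
      case 2
      then have "T \<subseteq> ?B w x z (?B x z z (?N z) (?B x y z L K)) J"
        using Q' unfolding Q'_def Q1 by (metis product_mono subset_refl)
      also have "\<dots> = ?B w z z (?N z) T"
        unfolding LK_J[symmetric] by (rule product_assoc[OF o(1,2,4,4) J LK R[OF o(4)]])
      finally show ?thesis using zeroL by blast
    qed
  qed
  have P'Q': "Q' \<or> T = {0}" if P: "\<not> P" and P': P'
  proof -
    have sub: "subbimodule A w y (?B w x y (?B x x y K (?N x)) J)"
      by (intro product_subbimodule o KN J)
    have "?B w x y (?B x x y K (?N x)) J \<subseteq> ?B w x y K J"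
      by (intro product_mono product_radical_subset o K subset_refl)
    with proper_subbimodule[OF o(1,3) sub KJ] P
    consider "?B w x y (?B x x y K (?N x)) J \<subseteq> ?B w w y (?B w x y K J) (?N w)"
      | "?B w x y (?B x x y K (?N x)) J \<subseteq> ?B w y y (?N y) (?B w x y K J)"
      unfolding P_def by blast
    then show ?thesis
    proof cases
      case 1
      then have "T \<subseteq> ?B w y z L (?B w w y (?B w x y K J) (?N w))"
        using P' unfolding P'_def P1 by (metis product_mono subset_refl)
      also have "\<dots> = ?B w w z T (?N w)"
        unfolding T_def by (rule product_assoc[OF o(1,1,3,4) R[OF o(1)] KJ L, symmetric])
      finally show ?thesis using zeroR by blast
    next
      case 2
      then have "T \<subseteq> ?B w y z L (?B w y y (?N y) (?B w x y K J))"
        using P' unfolding P'_def P1 by (metis product_mono subset_refl)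
      also have "\<dots> = ?B w y z (?B y y z L (?N y)) (?B w x y K J)"
        by (rule product_assoc[OF o(1,3,3,4) KJ R[OF o(3)] L, symmetric])
      finally show ?thesis using le_Q[OF Q1] unfolding Q'_def by blast
    qed
  qed
  \<comment> \<open>The conditions \<open>P \<or> Q'\<close> and \<open>Q \<or> P'\<close> are
    equivalent unless \<open>T = {0}\<close>, and then both branches have the value
    \<open>{0}\<close>.\<close>
  have "ray_product A w y z L (ray_product A w x y K J) = (if P \<or> Q' then {0} else T)"
    using ray_product_zero(2)[OF o(1,3,4) L] ray_product_eq[of w x y K J]
      ray_product_eq[of w y z L "?B w x y K J"]
    unfolding P_def Q'_def T_def by auto
  moreover have "ray_product A w x z (ray_product A x y z L K) J = (if Q \<or> P' then {0} else T)"
    using ray_product_zero(1)[OF o(1,2,4) J] ray_product_eq[of x y z L K]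
      ray_product_eq[of w x z "?B x y z L K" J]
    unfolding Q_def P'_def LK_J by auto
  ultimately show ?thesis using PP' QQ' P'Q' Q'P' by auto
qed

lemma ray_is_category: "is_category (ray_category A)"
  unfolding is_category_def ray_category_def
  by (auto simp: hom_subbimodule ray_product_subbimodule ray_product_ide ray_product_assoc)

end

text \<open>The identities serve as components of both natural isomorphisms. The inverse laws are
  asked for only on objects and hom-sets, as functors are arbitrary elsewhere.\<close>

lemma inverse_functors_equivalent:
  assumes "is_category C" "is_category D" and F: "is_functor C D F" and G: "is_functor D C G"
    and GF: "\<And>x. x \<in> Obj C \<Longrightarrow> FObj G (FObj F x) = x"
      "\<And>x y f. x \<in> Obj C \<Longrightarrow> y \<in> Obj C \<Longrightarrow> f \<in> Hom C x y \<Longrightarrow>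
        FMor G (FObj F x) (FObj F y) (FMor F x y f) = f"
    and FG: "\<And>x. x \<in> Obj D \<Longrightarrow> FObj F (FObj G x) = x"
      "\<And>x y f. x \<in> Obj D \<Longrightarrow> y \<in> Obj D \<Longrightarrow> f \<in> Hom D x y \<Longrightarrow>
        FMor F (FObj G x) (FObj G y) (FMor G x y f) = f"
  shows "equivalent_categories C D"
proof -
  \<comment> \<open>Kept general in the categories and their types, since it is applied once to each
    composite.\<close>
  have nat: "naturally_isomorphic C C (comp_functor G F) id_functor"
    if C: "is_category C" and o: "\<And>x. x \<in> Obj C \<Longrightarrow> FObj G (FObj F x) = x"
      and m: "\<And>x y f. x \<in> Obj C \<Longrightarrow> y \<in> Obj C \<Longrightarrow> f \<in> Hom C x y \<Longrightarrow>
        FMor G (FObj F x) (FObj F y) (FMor F x y f) = f"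
    for C :: "('u, 'v, 'w) category_scheme" and F :: "('u, 'v, 'x, 'y) cat_functor" and G
  proof -
    have id: "Ide C x \<in> Hom C x x" "Comp C x x y f (Ide C x) = f" "Comp C x y y (Ide C y) f = f"
      if "x \<in> Obj C" "y \<in> Obj C" "f \<in> Hom C x y" for x y f
      using C that unfolding is_category_def by blast+
    have "Ide C x \<in> Hom C x x" if "x \<in> Obj C" for x
      using C that unfolding is_category_def by blast
    then have "invertible C x x (Ide C x)" if "x \<in> Obj C" for x
      using that id(2)[of x x "Ide C x"] by (auto simp: invertible_def)
    then show ?thesis
      unfolding naturally_isomorphic_def comp_functor_def id_functor_def
      by (intro exI[of _ "Ide C"]) (simp add: o m id)
  qed
  show ?thesis
    unfolding equivalent_categories_def
    using assms(1,2) F G nat[OF assms(1), of G F, OF GF] nat[OF assms(2), of F G, OF FG] by blast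
qed

section \<open>Covering functors with the same fibres\<close>

locale covering =
  M: lb_cat M + N: lb_cat N
  for M :: "('k::field, 'o, 'm::ab_group_add) kcategory"
    and N :: "('k, 'p, 'n::ab_group_add) kcategory" +
  fixes F :: "('o, 'm, 'p, 'n) cat_functor"
  assumes covering: "covering_functor M N F"
begin

lemma functorial: "is_functor M N F"
  using covering by (simp add: covering_functor_def linear_functor_def)

lemma obj [simp]: "x \<in> Obj M \<Longrightarrow> FObj F x \<in> Obj N"
  using functorial by (simp add: is_functor_def)

lemma surj_obj: "x \<in> Obj N \<Longrightarrow> \<exists>u\<in>Obj M. FObj F u = x"
proof -
  assume "x \<in> Obj N"
  moreover have "FObj F ` Obj M = Obj N" using covering by (simp add: covering_functor_def)
  ultimately have "x \<in> FObj F ` Obj M" by simp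
  then show ?thesis by blast
qed

lemma mor_in [simp]:
  "x \<in> Obj M \<Longrightarrow> y \<in> Obj M \<Longrightarrow> f \<in> Hom M x y \<Longrightarrow> FMor F x y f \<in> Hom N (FObj F x) (FObj F y)"
  using functorial by (simp add: is_functor_def)

lemma mor_ide [simp]: "x \<in> Obj M \<Longrightarrow> FMor F x x (Ide M x) = Ide N (FObj F x)"
  using functorial by (simp add: is_functor_def)

lemma mor_comp:
  "x \<in> Obj M \<Longrightarrow> y \<in> Obj M \<Longrightarrow> z \<in> Obj M \<Longrightarrow> f \<in> Hom M x y \<Longrightarrow> g \<in> Hom M y z \<Longrightarrow>
    FMor F x z (Comp M x y z g f) =
      Comp N (FObj F x) (FObj F y) (FObj F z) (FMor F y z g) (FMor F x y f)"
  using functorial by (simp add: is_functor_def)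

lemma mor_add:
  "x \<in> Obj M \<Longrightarrow> y \<in> Obj M \<Longrightarrow> f \<in> Hom M x y \<Longrightarrow> g \<in> Hom M x y \<Longrightarrow>
    FMor F x y (f + g) = FMor F x y f + FMor F x y g"
  using covering by (simp add: covering_functor_def linear_functor_def)

lemma mor_scale [simp]:
  "x \<in> Obj M \<Longrightarrow> y \<in> Obj M \<Longrightarrow> f \<in> Hom M x y \<Longrightarrow> FMor F x y (Scale M c f) = Scale N c (FMor F x y f)"
  using covering by (simp add: covering_functor_def linear_functor_def)

lemma mor_zero [simp]: "x \<in> Obj M \<Longrightarrow> y \<in> Obj M \<Longrightarrow> FMor F x y 0 = 0"
  using mor_add[of x y 0 0] by simp

lemma direct_sum_bij:
  "w \<in> Obj M \<Longrightarrow> y \<in> Obj N \<Longrightarrow>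
    bij_betw (\<lambda>s. \<Sum>m | s m \<noteq> 0. FMor F w m (s m)) (direct_sum (fibre M F y) (Hom M w))
      (Hom N (FObj F w) y)"
  using covering unfolding covering_functor_def by blast

lemma sum_support:
  assumes "w \<in> Obj M" "finite S" "{m. s m \<noteq> 0} \<subseteq> S" "S \<subseteq> Obj M"
  shows "(\<Sum>m | s m \<noteq> 0. FMor F w m (s m)) = (\<Sum>m\<in>S. FMor F w m (s m))"
  using assms by (intro sum.mono_neutral_left) auto

text \<open>Decompose an inverse of \<open>F f\<close> into images of morphisms
  \<open>s i : m \<rightarrow> i\<close>. The morphisms \<open>s i \<circ> f\<close> then decompose
  the identity of \<open>F w\<close>, as does the identity of \<open>w\<close> alone. By uniqueness
  of the decomposition \<open>s w \<circ> f\<close> is the identity of \<open>w\<close>, so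
  \<open>f\<close> splits.\<close>

lemma unit_reflected:
  assumes o: "w \<in> Obj M" "m \<in> Obj M" "FObj F m = FObj F w" and f: "f \<in> Hom M w m"
    and inv: "invertible N (FObj F w) (FObj F w) (FMor F w m f)"
  shows "w = m \<and> invertible M w w f"
proof -
  obtain x where x: "FObj F w = x" by simp
  obtain g where g: "g \<in> Hom N x x" "Comp N x x x g (FMor F w m f) = Ide N x"
    using inv unfolding x by (auto simp: invertible_def)
  have "g \<in> (\<lambda>s. \<Sum>i | s i \<noteq> 0. FMor F m i (s i)) ` direct_sum (fibre M F x) (Hom M m)"
    using direct_sum_bij[OF o(2), of x] g(1) o(3) obj[OF o(1)] x by (simp add: bij_betw_def)
  then obtain s where s: "s \<in> direct_sum (fibre M F x) (Hom M m)"
    and g_sum: "g = (\<Sum>i | s i \<noteq> 0. FMor F m i (s i))" by blast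
  \<comment> \<open>\<open>w\<close> is added so that the component of \<open>r\<close> at
    \<open>w\<close> is the composition with \<open>s w\<close> even when
    \<open>s w = 0\<close>.\<close>
  define S where "S = insert w {i. s i \<noteq> 0}"
  have S: "finite S" "\<And>i. i \<in> S \<Longrightarrow> i \<in> Obj M \<and> FObj F i = x \<and> s i \<in> Hom M m i"
    using s o x by (auto simp: S_def direct_sum_def fibre_def)
  define r where "r i = (if i \<in> S then Comp M w m i (s i) f else 0)" for i
  define e where "e i = (if i = w then Ide M w else 0)" for i
  have r: "r \<in> direct_sum (fibre M F x) (Hom M w)"
    unfolding direct_sum_def
  proof (intro CollectI conjI ballI allI impI)
    show "r i \<in> Hom M w i" if "i \<in> fibre M F x" for i
      using that S(2)[of i] o f by (auto simp: r_def fibre_def)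
    show "r i = 0" if "i \<notin> fibre M F x" for i
      using that S(2)[of i] by (auto simp: r_def fibre_def)
    show "finite {i. r i \<noteq> 0}"
      by (rule finite_subset[OF _ S(1)]) (auto simp: r_def)
  qed
  have e: "e \<in> direct_sum (fibre M F x) (Hom M w)"
    using o x by (auto simp: direct_sum_def e_def fibre_def)
  have gS: "(\<Sum>i\<in>S. FMor F m i (s i)) = g"
    unfolding g_sum using o S by (intro sum_support[symmetric]) (auto simp: S_def)
  have "(\<Sum>i | r i \<noteq> 0. FMor F w i (r i)) = (\<Sum>i\<in>S. FMor F w i (r i))"
    using o S by (intro sum_support) (auto simp: r_def)
  also have "\<dots> = (\<Sum>i\<in>S. Comp N x x x (FMor F m i (s i)) (FMor F w m f))"
    using S(2) o f x by (intro sum.cong refl) (simp add: r_def mor_comp)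
  also have "\<dots> = Comp N x x x (\<Sum>i\<in>S. FMor F m i (s i)) (FMor F w m f)"
  proof -
    have Ff: "FMor F w m f \<in> Hom N x x" using mor_in[OF o(1,2) f] o(3) x by simp
    have "(\<Sum>i\<in>T. FMor F m i (s i)) \<in> Hom N x x \<and>
      (\<Sum>i\<in>T. Comp N x x x (FMor F m i (s i)) (FMor F w m f)) =
      Comp N x x x (\<Sum>i\<in>T. FMor F m i (s i)) (FMor F w m f)" if "finite T" "T \<subseteq> S" for T
      using that
    proof (induction T)
      case empty
      then show ?case using obj[OF o(1)] x Ff by simp
    next
      case (insert i T)
      have "FMor F m i (s i) \<in> Hom N x x"
        using S(2)[of i] insert.prems mor_in[of m i "s i"] o x by simp
      then show ?case using insert obj[OF o(1)] x Ff by (simp add: N.comp_add)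
    qed
    then show ?thesis using S(1) by blast
  qed
  also have "\<dots> = (\<Sum>i\<in>{w}. FMor F w i (e i))"
    unfolding gS using g(2) o x by (simp add: e_def)
  also have "\<dots> = (\<Sum>i | e i \<noteq> 0. FMor F w i (e i))"
    using o by (intro sum_support[symmetric]) (auto simp: e_def)
  finally have "r = e"
    using direct_sum_bij[OF o(1), of x] r e obj[OF o(1)] x unfolding bij_betw_def inj_on_def by auto
  then have "Comp M w m w (s w) f = Ide M w"
    by (auto simp: r_def e_def S_def dest: fun_cong[of _ _ w])
  moreover have "s w \<in> Hom M m w" using S(2)[of w] by (simp add: S_def)
  ultimately show ?thesis
    using M.split_obj_eq[OF o(1,2) f] M.split_invertible[OF o(1,2) f] by blast
qed

lemma unit_preserved:
  assumes "w \<in> Obj M" "invertible M w w f"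
  shows "invertible N (FObj F w) (FObj F w) (FMor F w w f)"
proof -
  obtain g where g: "f \<in> Hom M w w" "g \<in> Hom M w w" "Comp M w w w g f = Ide M w"
    using assms(2) by (auto simp: invertible_def)
  then show ?thesis
    using assms(1) mor_comp[of w w w f g]
    by (intro N.split_invertible(1)[of _ _ _ "FMor F w w g"]) simp_all
qed

end

text \<open>
  \<open>matched M F F' y y' J J' w a a'\<close> says \<open>a' = \<Phi>\<^sub>w(a)\<close>, where \<open>a\<close> has the components \<open>f\<close> with \<open>F f \<in> J\<close>
  and \<open>F' f \<in> J'\<close>. The relation is symmetric in \<open>F\<close> and \<open>F'\<close>, so every statement also holds with the two swapped.
\<close>

inductive matched ::
  "('k::field, 'o, 'm::ab_group_add) kcategory \<Rightarrow> ('o, 'm, 'p, 'n::ab_group_add) cat_functor \<Rightarrow>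
     ('o, 'm, 'q, 'l::ab_group_add) cat_functor \<Rightarrow> 'p \<Rightarrow> 'q \<Rightarrow> 'n set \<Rightarrow> 'l set \<Rightarrow> 'o \<Rightarrow> 'n \<Rightarrow> 'l \<Rightarrow> bool"
  for M F F' y y' J J' w
where
  zero: "matched M F F' y y' J J' w 0 0"
| add: "m \<in> Obj M \<Longrightarrow> FObj F m = y \<Longrightarrow> FObj F' m = y' \<Longrightarrow> f \<in> Hom M w m \<Longrightarrow>
    FMor F w m f \<in> J \<Longrightarrow> FMor F' w m f \<in> J' \<Longrightarrow> matched M F F' y y' J J' w a a' \<Longrightarrow>
    matched M F F' y y' J J' w (FMor F w m f + a) (FMor F' w m f + a')"

text \<open>The value \<open>a'\<close> may depend on \<open>w\<close>; that it always comes from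
  components with image in \<open>J'\<close> is the uniformity that matters.\<close>

definition lifts ::
  "('k::field, 'o, 'm::ab_group_add) kcategory \<Rightarrow> ('o, 'm, 'p, 'n::ab_group_add) cat_functor \<Rightarrow>
     ('o, 'm, 'q, 'l::ab_group_add) cat_functor \<Rightarrow> 'p \<Rightarrow> 'q \<Rightarrow> 'p \<Rightarrow> 'q \<Rightarrow> 'n set \<Rightarrow> 'l set \<Rightarrow> bool"
where
  "lifts M F F' x x' y y' J J' \<longleftrightarrow>
     (\<forall>w\<in>Obj M. FObj F w = x \<longrightarrow> FObj F' w = x' \<longrightarrow> (\<forall>a\<in>J. \<exists>a'. matched M F F' y y' J J' w a a'))"

definition corresponding ::
  "('k::field, 'o, 'm::ab_group_add) kcategory \<Rightarrow> ('k, 'p, 'n::ab_group_add) kcategory \<Rightarrow>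
     ('k, 'q, 'l::ab_group_add) kcategory \<Rightarrow> ('o, 'm, 'p, 'n) cat_functor \<Rightarrow>
     ('o, 'm, 'q, 'l) cat_functor \<Rightarrow> 'p \<Rightarrow> 'q \<Rightarrow> 'p \<Rightarrow> 'q \<Rightarrow> 'n set \<Rightarrow> 'l set \<Rightarrow> bool"
where
  "corresponding M A A' F F' x x' y y' J J' \<longleftrightarrow>
     subbimodule A x y J \<and> subbimodule A' x' y' J' \<and>
     lifts M F F' x x' y y' J J' \<and> lifts M F' F x' x y' y J' J"

text \<open>For covering functors with equal fibres this is the graph of a bijection between the
  objects of \<open>A\<close> and of \<open>A'\<close>.\<close>

definition over ::
  "('k::field, 'o, 'm::ab_group_add) kcategory \<Rightarrow> ('o, 'm, 'p, 'n) cat_functor \<Rightarrow>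
     ('o, 'm, 'q, 'l) cat_functor \<Rightarrow> 'p \<Rightarrow> 'q \<Rightarrow> bool"
where
  "over M F F' x x' \<longleftrightarrow> (\<exists>u\<in>Obj M. FObj F u = x \<and> FObj F' u = x')"

lemma matched_swap:
  assumes "matched M F F' y y' J J' w a a'"
  shows "matched M F' F y' y J' J w a' a"
  using assms by induction (auto intro: matched.intros)

lemma corresponding_swap:
  "corresponding M A A' F F' x x' y y' J J' \<Longrightarrow> corresponding M A' A F' F x' x y' y J' J"
  by (auto simp: corresponding_def)

lemma over_swap: "over M F F' x x' \<Longrightarrow> over M F' F x' x"
  by (auto simp: over_def)

lemma matched_mono:
  assumes "matched M F F' y y' J J' w a a'" "J \<subseteq> K" "J' \<subseteq> K'"
  shows "matched M F F' y y' K K' w a a'"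
  using assms by induction (auto intro!: matched.intros)

lemma matched_append:
  assumes "matched M F F' y y' J J' w a a'" "matched M F F' y y' J J' w b b'"
  shows "matched M F F' y y' J J' w (a + b) (a' + b')"
  using assms by induction (auto simp: add.assoc intro!: matched.intros)

locale covering_pair =
  C: covering M A F + C': covering M A' F'
  for M :: "('k::field, 'o, 'm::ab_group_add) kcategory"
    and A :: "('k, 'p, 'n::ab_group_add) kcategory"
    and A' :: "('k, 'q, 'l::ab_group_add) kcategory"
    and F :: "('o, 'm, 'p, 'n) cat_functor"
    and F' :: "('o, 'm, 'q, 'l) cat_functor" +
  assumes fibres: "\<And>u v. u \<in> Obj M \<Longrightarrow> v \<in> Obj M \<Longrightarrow> FObj F u = FObj F v \<longleftrightarrow> FObj F' u = FObj F' v"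
begin

lemma swap: "covering_pair M A' A F' F"
  by unfold_locales (simp add: fibres)

abbreviation "match \<equiv> matched M F F'"
abbreviation "corr \<equiv> corresponding M A A' F F'"
abbreviation "ov \<equiv> over M F F'"

lemma overD:
  assumes "ov x x'"
  shows "x \<in> Obj A" "x' \<in> Obj A'" "w \<in> Obj M \<Longrightarrow> FObj F w = x \<Longrightarrow> FObj F' w = x'"
    "w \<in> Obj M \<Longrightarrow> FObj F' w = x' \<Longrightarrow> FObj F w = x"
  using assms fibres by (auto simp: over_def)

section \<open>Existence and uniqueness of the matching element\<close>

lemma match_in:
  assumes "match y y' J J' w a a'" "subbimodule A x y J" "subbimodule A' x' y' J'"
  shows "a \<in> J" "a' \<in> J'"
  using assms by (induction) (auto simp: C.N.subbimoduleD C'.N.subbimoduleD)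

lemma match_neg:
  assumes "match y y' J J' w a a'" "subbimodule A x y J" "subbimodule A' x' y' J'" "w \<in> Obj M"
  shows "match y y' J J' w (- a) (- a')"
  using assms
proof (induction)
  case zero
  then show ?case by (simp add: matched.zero)
next
  case (add m f a a')
  have neg: "FMor F w m (Scale M (-1) f) = - FMor F w m f" "FMor F' w m (Scale M (-1) f) = - FMor F' w m f"
    using add by (subst C.mor_scale C'.mor_scale; simp)+
  have "- FMor F w m f \<in> J" "- FMor F' w m f \<in> J'"
    using C.N.subbimoduleD(4)[OF assms(2) C.N.subbimoduleD(2)[OF assms(2)] add(5)]
      C'.N.subbimoduleD(4)[OF assms(3) C'.N.subbimoduleD(2)[OF assms(3)] add(6)] by simp_all
  then have "match y y' J J' w (FMor F w m (Scale M (-1) f) + - a) (FMor F' w m (Scale M (-1) f) + - a')"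
    using add neg by (intro matched.add C.M.scale_in) simp_all
  then show ?case unfolding neg by (simp add: add.commute)
qed

text \<open>In \<open>matched\<close> an end point may occur repeatedly; adding up the morphisms
  with the same end point gives one family that represents \<open>a\<close> under \<open>F\<close>
  and \<open>a'\<close> under \<open>F'\<close>. Uniqueness of decompositions then becomes
  applicable.\<close>

lemma match_direct_sum:
  assumes "match y y' J J' w a a'" "w \<in> Obj M"
  shows "\<exists>s\<in>direct_sum (fibre M F y) (Hom M w).
    a = (\<Sum>m | s m \<noteq> 0. FMor F w m (s m)) \<and> a' = (\<Sum>m | s m \<noteq> 0. FMor F' w m (s m))"
  using assms(1)
proof induction
  case zero
  then show ?case using assms(2) by (intro bexI[of _ "\<lambda>_. 0"]) (auto simp: direct_sum_def fibre_def)
next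
  case (add m f a a')
  then obtain s where s: "s \<in> direct_sum (fibre M F y) (Hom M w)"
    "a = (\<Sum>m | s m \<noteq> 0. FMor F w m (s m))" "a' = (\<Sum>m | s m \<noteq> 0. FMor F' w m (s m))" by blast
  \<comment> \<open>A common index set for the old and the new family; the support of
    \<open>r\<close> may lose \<open>m\<close> by cancellation.\<close>
  define S where "S = insert m {i. s i \<noteq> 0}"
  define r where "r = s(m := f + s m)"
  have S: "finite S" "S \<subseteq> Obj M" "\<And>i. i \<in> S \<Longrightarrow> s i \<in> Hom M w i"
    using s(1) add(1-4) by (auto simp: S_def direct_sum_def fibre_def)
  have supp: "{i. r i \<noteq> 0} \<subseteq> S" "{i. s i \<noteq> 0} \<subseteq> S" by (auto simp: r_def S_def)
  have "r \<in> direct_sum (fibre M F y) (Hom M w)"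
    using s(1) add(1-4) assms(2) finite_subset[OF supp(1) S(1)]
    by (auto simp: direct_sum_def r_def fibre_def)
  \<comment> \<open>Stated for an arbitrary \<open>G\<close> because it is needed for both
    functors.\<close>
  moreover have split: "(\<Sum>i\<in>S. G i (r i)) = G m (f + s m) + (\<Sum>i\<in>S - {m}. G i (s i))"
    "(\<Sum>i\<in>S. G i (s i)) = G m (s m) + (\<Sum>i\<in>S - {m}. G i (s i))"
    for G :: "'o \<Rightarrow> 'm \<Rightarrow> 'z::ab_group_add"
  proof -
    have m: "m \<in> S" by (simp add: S_def)
    show "(\<Sum>i\<in>S. G i (r i)) = G m (f + s m) + (\<Sum>i\<in>S - {m}. G i (s i))"
      unfolding sum.remove[OF S(1) m] by (simp add: r_def)
    show "(\<Sum>i\<in>S. G i (s i)) = G m (s m) + (\<Sum>i\<in>S - {m}. G i (s i))"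
      by (rule sum.remove[OF S(1) m])
  qed
  have "FMor F w m f + a = (\<Sum>i | r i \<noteq> 0. FMor F w i (r i))"
    unfolding s(2) C.sum_support[OF assms(2) S(1) supp(1) S(2)] C.sum_support[OF assms(2) S(1) supp(2) S(2)]
      split[of "FMor F w"]
    using S(3)[of m] assms(2) add(1,4) by (simp add: C.mor_add S_def add.assoc)
  moreover have "FMor F' w m f + a' = (\<Sum>i | r i \<noteq> 0. FMor F' w i (r i))"
    unfolding s(3) C'.sum_support[OF assms(2) S(1) supp(1) S(2)] C'.sum_support[OF assms(2) S(1) supp(2) S(2)]
      split[of "FMor F' w"]
    using S(3)[of m] assms(2) add(1,4) by (simp add: C'.mor_add S_def add.assoc)
  ultimately show ?case by blast
qed

text \<open>The only family representing \<open>0\<close> under \<open>F\<close> is the zero family.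
  Together with additivity this makes \<open>\<Phi>\<^sub>w\<close> well defined.\<close>

lemma match_zero:
  assumes "match y y' J J' w 0 a'" "w \<in> Obj M" "y \<in> Obj A"
  shows "a' = 0"
proof -
  obtain s where s: "s \<in> direct_sum (fibre M F y) (Hom M w)"
    "0 = (\<Sum>m | s m \<noteq> 0. FMor F w m (s m))" "a' = (\<Sum>m | s m \<noteq> 0. FMor F' w m (s m))"
    using match_direct_sum[OF assms(1,2)] by blast
  have zero: "(\<lambda>_. 0) \<in> direct_sum (fibre M F y) (Hom M w)"
    using assms(2) by (auto simp: direct_sum_def fibre_def)
  have "s = (\<lambda>_. 0)"
    by (rule inj_onD[OF bij_betw_imp_inj_on[OF C.direct_sum_bij[OF assms(2,3)]] _ s(1) zero])
      (simp flip: s(2))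
  then show ?thesis using s(3) by simp
qed

text \<open>The two matchings are subtracted inside the full hom-spaces, so the subbimodules that
  control them may differ.\<close>

lemma match_unique:
  assumes "match y y' J J' w a a'" "match y y' K K' w a b'" "w \<in> Obj M" "ov y y'"
    and "subbimodule A (FObj F w) y J" "subbimodule A' (FObj F' w) y' J'"
    and "subbimodule A (FObj F w) y K" "subbimodule A' (FObj F' w) y' K'"
  shows "a' = b'"
proof -
  note o = overD(1,2)[OF assms(4)] and hom = C.N.hom_subbimodule C'.N.hom_subbimodule
  let ?H = "Hom A (FObj F w) y" and ?H' = "Hom A' (FObj F' w) y'"
  have sub: "J \<subseteq> ?H" "J' \<subseteq> ?H'" "K \<subseteq> ?H" "K' \<subseteq> ?H'"
    using assms(5-8) by (simp_all add: subbimodule_def)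
  have "match y y' ?H ?H' w (a + - a) (a' + - b')"
    by (rule matched_append[OF matched_mono[OF assms(1) sub(1,2)]
          match_neg[OF matched_mono[OF assms(2) sub(3,4)] hom assms(3)]])
      (simp_all add: o assms(3))
  then show ?thesis using match_zero[of y y' ?H ?H' w "a' + - b'"] assms(3) o by simp
qed

lemma match_exists:
  assumes "a \<in> Hom A (FObj F w) y" "w \<in> Obj M" "ov y y'"
  shows "\<exists>a'. match y y' (Hom A (FObj F w) y) (Hom A' (FObj F' w) y') w a a'"
proof -
  note o = overD(1,2)[OF assms(3)]
  have "a \<in> (\<lambda>s. \<Sum>m | s m \<noteq> 0. FMor F w m (s m)) ` direct_sum (fibre M F y) (Hom M w)"
    using assms C.direct_sum_bij[OF assms(2) o(1)] by (simp add: bij_betw_def)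
  then obtain s where s: "s \<in> direct_sum (fibre M F y) (Hom M w)" "a = (\<Sum>m | s m \<noteq> 0. FMor F w m (s m))"
    by blast
  have "match y y' (Hom A (FObj F w) y) (Hom A' (FObj F' w) y') w
      (\<Sum>m\<in>S. FMor F w m (s m)) (\<Sum>m\<in>S. FMor F' w m (s m))" if "finite S" "S \<subseteq> {m. s m \<noteq> 0}" for S
    using that
  proof (induction S)
    case (insert m S)
    then have "m \<in> Obj M" "FObj F m = y" "FObj F' m = y'" "s m \<in> Hom M w m"
      using s(1) overD(3)[OF assms(3)] by (auto simp: direct_sum_def fibre_def)
    then show ?case
      using insert assms(2) C.mor_in[of w m "s m"] C'.mor_in[of w m "s m"] by (auto intro: matched.add)
  qed (simp add: matched.zero)
  moreover have "finite {m. s m \<noteq> 0}" using s(1) by (simp add: direct_sum_def)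
  ultimately show ?thesis unfolding s(2) by blast
qed

end

section \<open>Corresponding subbimodules\<close>

context covering_pair
begin

lemma corrD:
  assumes "corr x x' y y' J J'"
  shows "subbimodule A x y J" "subbimodule A' x' y' J'"
    and "w \<in> Obj M \<Longrightarrow> FObj F w = x \<Longrightarrow> FObj F' w = x' \<Longrightarrow> a \<in> J \<Longrightarrow> \<exists>a'. match y y' J J' w a a'"
    and "w \<in> Obj M \<Longrightarrow> FObj F w = x \<Longrightarrow> FObj F' w = x' \<Longrightarrow> a' \<in> J' \<Longrightarrow> \<exists>a. match y y' J J' w a a'"
proof -
  show "subbimodule A x y J" "subbimodule A' x' y' J'"
    using assms by (simp_all add: corresponding_def)
  show "\<exists>a'. match y y' J J' w a a'" if "w \<in> Obj M" "FObj F w = x" "FObj F' w = x'" "a \<in> J"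
    using assms that by (simp add: corresponding_def lifts_def)
  assume "w \<in> Obj M" "FObj F w = x" "FObj F' w = x'" "a' \<in> J'"
  moreover have "lifts M F' F x' x y' y J' J" using assms by (simp add: corresponding_def)
  ultimately obtain a where "matched M F' F y' y J' J w a' a"
    unfolding lifts_def by blast
  then have "match y y' J J' w a a'" by (rule matched_swap)
  then show "\<exists>a. match y y' J J' w a a'" by (rule exI)
qed

text \<open>An element of \<open>J'\<close> is pulled back to \<open>J\<close> from one base object
  \<open>u\<close> and pushed forward into \<open>K'\<close> from the same \<open>u\<close>;
  uniqueness identifies the two images.\<close>

lemma corr_subset:
  assumes o: "ov x x'" "ov y y'" and J: "corr x x' y y' J J'" and K: "corr x x' y y' J K'"
  shows "J' \<subseteq> K'"
proof
  fix a' assume a': "a' \<in> J'"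
  obtain u where u: "u \<in> Obj M" "FObj F u = x" "FObj F' u = x'" using o(1) by (auto simp: over_def)
  obtain a where a: "match y y' J J' u a a'" using corrD(4)[OF J u a'] by blast
  then have "a \<in> J" using match_in(1) corrD(1,2)[OF J] by blast
  then obtain b' where b': "match y y' J K' u a b'" using corrD(3)[OF K u] by blast
  have "a' = b'"
    by (rule match_unique[OF a b' u(1) o(2)]) (simp_all add: u corrD[OF J] corrD[OF K])
  then show "a' \<in> K'" using match_in(2)[OF b' corrD(1,2)[OF K]] by simp
qed

lemma corr_unique:
  assumes "ov x x'" "ov y y'" "corr x x' y y' J J'" "corr x x' y y' J K'"
  shows "J' = K'"
  using corr_subset[OF assms] corr_subset[OF assms(1,2,4,3)] by blast

lemma corr_unique_left:
  assumes "ov x x'" "ov y y'" "corr x x' y y' J J'" "corr x x' y y' K J'"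
  shows "J = K"
  by (rule covering_pair.corr_unique[OF swap over_swap[OF assms(1)] over_swap[OF assms(2)]
        corresponding_swap[OF assms(3)] corresponding_swap[OF assms(4)]])

lemma lifts_hom:
  assumes "ov y y'"
  shows "lifts M F F' x x' y y' (Hom A x y) (Hom A' x' y')"
  unfolding lifts_def using match_exists[OF _ _ assms] by auto

lemma corr_hom:
  assumes "ov x x'" "ov y y'"
  shows "corr x x' y y' (Hom A x y) (Hom A' x' y')"
  unfolding corresponding_def
  using lifts_hom[OF assms(2)] covering_pair.lifts_hom[OF swap over_swap[OF assms(2)]]
    overD(1,2)[OF assms(1)] overD(1,2)[OF assms(2)]
  by (simp add: C.N.hom_subbimodule C'.N.hom_subbimodule)

lemma corr_zero:
  assumes "ov x x'" "ov y y'"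
  shows "corr x x' y y' {0} {0}"
  using overD(1,2)[OF assms(1)] overD(1,2)[OF assms(2)] unfolding corresponding_def lifts_def
  by (auto simp: C.N.zero_subbimodule C'.N.zero_subbimodule intro: matched.zero)

text \<open>By \<open>unit_reflected\<close> every component ending outside \<open>w\<close> lies in
  both radicals. What is left is an endomorphism \<open>c\<close> of \<open>w\<close> with radical
  image under \<open>F\<close>; it is no unit in \<open>M\<close>, so its image under
  \<open>F'\<close> is radical as well.\<close>

lemma lifts_radical:
  assumes o: "ov x x'"
  shows "lifts M F F' x x' x x' (radical A x x) (radical A' x' x')"
  unfolding lifts_def
proof (intro ballI impI)
  fix w a assume w: "w \<in> Obj M" "FObj F w = x" "FObj F' w = x'" and a: "a \<in> radical A x x"
  note o' = overD(1,2)[OF o]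
  let ?R = "radical A x x" and ?R' = "radical A' x' x'"
  have "a \<in> Hom A (FObj F w) x" using a o' w by (simp add: C.N.radical_iff)
  then obtain a' where "match x x' (Hom A x x) (Hom A' x' x') w a a'"
    using match_exists[OF _ w(1) o] w by auto
  \<comment> \<open>All components that end in \<open>w\<close> are collected in
    \<open>c\<close>.\<close>
  then have "\<exists>c\<in>Hom M w w. \<exists>b b'. match x x' ?R ?R' w b b' \<and> a = FMor F w w c + b \<and> a' = FMor F' w w c + b'"
  proof induction
    case zero
    then show ?case using w by (intro bexI[of _ 0] exI[of _ 0]) (simp_all add: matched.zero)
  next
    case (add m f a a')
    then obtain c b b' where c: "c \<in> Hom M w w" and b: "match x x' ?R ?R' w b b'"
      and ab: "a = FMor F w w c + b" "a' = FMor F' w w c + b'" by blast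
    show ?case
    proof (cases "m = w")
      case True
      then show ?thesis using add(4) b c ab w
        by (intro bexI[of _ "f + c"] exI[of _ b] exI[of _ b'])
          (simp_all add: C.mor_add C'.mor_add add.assoc)
    next
      case False
      have "FMor F w m f \<in> ?R"
        using C.unit_reflected[OF w(1) add(1) _ add(4)] False w add o' by (auto simp: C.N.radical_iff)
      moreover have "FMor F' w m f \<in> ?R'"
        using C'.unit_reflected[OF w(1) add(1) _ add(4)] False w add o' by (auto simp: C'.N.radical_iff)
      ultimately have "match x x' ?R ?R' w (FMor F w m f + b) (FMor F' w m f + b')"
        using add(1-4) b by (intro matched.add)
      moreover have "FMor F w m f + a = FMor F w w c + (FMor F w m f + b)"
        "FMor F' w m f + a' = FMor F' w w c + (FMor F' w m f + b')"
        using ab by simp_all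
      ultimately show ?thesis using c by blast
    qed
  qed
  then obtain c b b' where c: "c \<in> Hom M w w" and b: "match x x' ?R ?R' w b b'"
    and ab: "a = FMor F w w c + b" by blast
  note R = C.N.radical_subbimodule[OF o'(1)] and R' = C'.N.radical_subbimodule[OF o'(2)]
  have Fc: "FMor F w w c \<in> ?R"
    using C.N.subbimoduleD(4)[OF R a match_in(1)[OF b R R']] ab by simp
  have "FMor F' w w c \<in> ?R'"
  proof -
    have "\<not> invertible A' x' x' (FMor F' w w c)"
    proof
      assume "invertible A' x' x' (FMor F' w w c)"
      then have "invertible M w w c" using C'.unit_reflected[OF w(1,1) refl c] w(3) by simp
      then have "invertible A x x (FMor F w w c)" using C.unit_preserved[OF w(1)] w(2) by simp
      then show False using Fc o' by (simp add: C.N.radical_iff)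
    qed
    then show ?thesis using C'.mor_in[OF w(1,1) c] w(3) o' by (simp add: C'.N.radical_iff)
  qed
  then show "\<exists>a'. match x x' ?R ?R' w a a'"
    unfolding ab using matched.add[OF w c Fc _ b] by blast
qed

lemma corr_radical:
  assumes "ov x x'"
  shows "corr x x' x x' (radical A x x) (radical A' x' x')"
  unfolding corresponding_def
  using lifts_radical[OF assms] covering_pair.lifts_radical[OF swap over_swap[OF assms]] overD(1,2)[OF assms]
  by (simp add: C.N.radical_subbimodule C'.N.radical_subbimodule)

text \<open>Each component \<open>g\<close> of \<open>b\<close> starts in \<open>m\<close>, so
  \<open>g \<circ> f\<close> starts in \<open>w\<close> and is a component of the composition.
  Products of subbimodules record where the components lie.\<close>

lemma match_comp:
  assumes "match z z' K K' m b b'"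
    and o: "m \<in> Obj M" "w \<in> Obj M" "FObj F w = x" "FObj F' w = x'" "FObj F m = y" "FObj F' m = y'" "ov z z'"
    and f: "f \<in> Hom M w m" "FMor F w m f \<in> J" "FMor F' w m f \<in> J'"
    and J: "subbimodule A x y J" and J': "subbimodule A' x' y' J'"
    and K: "subbimodule A y z K" and K': "subbimodule A' y' z' K'"
  shows "match z z' (bimodule_product A x y z K J) (bimodule_product A' x' y' z' K' J') w
    (Comp A x y z b (FMor F w m f)) (Comp A' x' y' z' b' (FMor F' w m f))"
  using assms(1)
proof induction
  note oz = overD(1,2)[OF o(7)]
  have obj: "x \<in> Obj A" "x' \<in> Obj A'" "y \<in> Obj A" "y' \<in> Obj A'"
    using o C.obj C'.obj by blast+
  case zero
  have "FMor F w m f \<in> Hom A x y" "FMor F' w m f \<in> Hom A' x' y'"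
    using f J J' C.N.subbimoduleD(1) C'.N.subbimoduleD(1) by blast+
  then show ?case using oz obj by (simp add: matched.zero)
next
  note oz = overD(1,2)[OF o(7)]
  have obj: "x \<in> Obj A" "x' \<in> Obj A'" "y \<in> Obj A" "y' \<in> Obj A'"
    using o C.obj C'.obj by blast+
  case (add l g b b')
  have fin: "FMor F w m f \<in> Hom A x y" "FMor F' w m f \<in> Hom A' x' y'"
    using f J J' C.N.subbimoduleD(1) C'.N.subbimoduleD(1) by blast+
  have gin: "FMor F m l g \<in> Hom A y z" "FMor F' m l g \<in> Hom A' y' z'"
    using add(5,6) K K' C.N.subbimoduleD(1) C'.N.subbimoduleD(1) by blast+
  have bin: "b \<in> Hom A y z" "b' \<in> Hom A' y' z'"
    using match_in[OF add(7) K K'] K K' C.N.subbimoduleD(1) C'.N.subbimoduleD(1) by blast+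
  have gf: "FMor F w l (Comp M w m l g f) = Comp A x y z (FMor F m l g) (FMor F w m f)"
    "FMor F' w l (Comp M w m l g f) = Comp A' x' y' z' (FMor F' m l g) (FMor F' w m f)"
    using C.mor_comp[OF o(2,1) add(1) f(1) add(4)] C'.mor_comp[OF o(2,1) add(1) f(1) add(4)] add(2,3) o
    by simp_all
  have "match z z' (bimodule_product A x y z K J) (bimodule_product A' x' y' z' K' J') w
      (FMor F w l (Comp M w m l g f) + Comp A x y z b (FMor F w m f))
      (FMor F' w l (Comp M w m l g f) + Comp A' x' y' z' b' (FMor F' w m f))"
  proof (rule matched.add[OF add(1-3) C.M.comp_in[OF o(2,1) add(1) f(1) add(4)] _ _ add(8)])
    show "FMor F w l (Comp M w m l g f) \<in> bimodule_product A x y z K J"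
      unfolding gf by (rule C.N.product_in[OF obj(1,3) oz(1) J K add(5) f(2)])
    show "FMor F' w l (Comp M w m l g f) \<in> bimodule_product A' x' y' z' K' J'"
      unfolding gf by (rule C'.N.product_in[OF obj(2,4) oz(2) J' K' add(6) f(3)])
  qed
  then show ?case
    unfolding gf using C.N.comp_add(2)[OF obj(1,3) oz(1) fin(1) gin(1) bin(1)]
      C'.N.comp_add(2)[OF obj(2,4) oz(2) fin(2) gin(2) bin(2)] by simp
qed

lemma lifts_product:
  assumes o: "ov x x'" "ov y y'" "ov z z'"
    and J: "corr x x' y y' J J'" and K: "corr y y' z z' K K'"
  shows "lifts M F F' x x' z z' (bimodule_product A x y z K J) (bimodule_product A' x' y' z' K' J')"
  unfolding lifts_def
proof (intro ballI impI)
  let ?P = "bimodule_product A x y z K J" and ?P' = "bimodule_product A' x' y' z' K' J'"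
  note obj = overD(1)[OF o(1)] overD(1)[OF o(2)] overD(1)[OF o(3)]
  fix w a assume w: "w \<in> Obj M" "FObj F w = x" "FObj F' w = x'" and a: "a \<in> ?P"
  have *: "\<exists>c'. match z z' ?P ?P' w (Comp A x y z k j) c'" if k: "k \<in> K" and j: "j \<in> J" for k j
  proof -
    obtain j' where "match y y' J J' w j j'" using corrD(3)[OF J w j] by blast
    then show ?thesis
    proof induction
      case zero
      have "Comp A x y z k 0 = 0" using obj C.N.subbimoduleD(1)[OF corrD(1)[OF K] k] by simp
      then show ?case using matched.zero by metis
    next
      case (add m f a a')
      then obtain c' where c': "match z z' ?P ?P' w (Comp A x y z k a) c'" by blast
      \<comment> \<open>The base object for \<open>k\<close> is the end point \<open>m\<close> of
        the component \<open>f\<close> and changes with it; here it matters that \<open>K\<close>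
        lifts from every object.\<close>
      obtain k' where k': "match z z' K K' m k k'" using corrD(3)[OF K add(1-3) k] by blast
      have "match z z' ?P ?P' w (Comp A x y z k (FMor F w m f)) (Comp A' x' y' z' k' (FMor F' w m f))"
        by (rule match_comp[OF k' add(1) w add(2,3) o(3) add(4-6)]) (rule corrD[OF J] corrD[OF K])+
      from matched_append[OF this c'] show ?case
        using obj C.N.subbimoduleD(1)[OF corrD(1)[OF K] k] C.N.subbimoduleD(1)[OF corrD(1)[OF J] add(5)]
          C.N.subbimoduleD(1)[OF corrD(1)[OF J] match_in(1)[OF add(7) corrD(1,2)[OF J]]]
        by (auto simp: C.N.comp_add)
    qed
  qed
  show "\<exists>a'. match z z' ?P ?P' w a a'"
    using a
  proof (induction rule: C.N.product_induct[OF obj corrD(1)[OF J] corrD(1)[OF K], consumes 1, case_names zero add])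
    case zero
    show ?case by (rule exI, rule matched.zero)
  next
    case (add k j a)
    then obtain a' c' where "match z z' ?P ?P' w (Comp A x y z k j) c'" "match z z' ?P ?P' w a a'"
      using *[OF add(1,2)] by blast
    from matched_append[OF this] show ?case by (rule exI)
  qed
qed

lemma corr_product:
  assumes o: "ov x x'" "ov y y'" "ov z z'"
    and J: "corr x x' y y' J J'" and K: "corr y y' z z' K K'"
  shows "corr x x' z z' (bimodule_product A x y z K J) (bimodule_product A' x' y' z' K' J')"
proof -
  have "lifts M F' F x' x z' z (bimodule_product A' x' y' z' K' J') (bimodule_product A x y z K J)"
    by (rule covering_pair.lifts_product[OF swap o[THEN over_swap]
          corresponding_swap[OF J] corresponding_swap[OF K]])
  then show ?thesis
    unfolding corresponding_def using lifts_product[OF assms]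
      overD(1,2)[OF o(1)] overD(1,2)[OF o(2)] overD(1,2)[OF o(3)] corrD(1,2)[OF J] corrD(1,2)[OF K]
    by (simp add: C.N.product_subbimodule C'.N.product_subbimodule)
qed

text \<open>The coefficient \<open>b\<close> is lifted from the end point \<open>m\<close> of
  \<open>g\<close>, and \<open>match_comp\<close> with uniqueness identifies \<open>a'\<close>.
  Right multiples admit no such argument: components of the right factor end in various objects,
  from which \<open>F g\<close> would have to be lifted anew.\<close>

lemma corr_left_multiple:
  assumes o: "ov x x'" "ov y y'" and J: "corr x x' y y' J J'"
    and w: "w \<in> Obj M" "FObj F w = x" and m: "m \<in> Obj M" "FObj F m = y" and g: "g \<in> Hom M w m"
    and mult: "\<forall>a\<in>J. \<exists>b\<in>Hom A y y. a = Comp A x y y b (FMor F w m g)" and a': "a' \<in> J'"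
  shows "\<exists>b'\<in>Hom A' y' y'. a' = Comp A' x' y' y' b' (FMor F' w m g)"
proof -
  note obj = overD(1,2)[OF o(1)] overD(1,2)[OF o(2)]
  have w': "FObj F' w = x'" and m': "FObj F' m = y'" using overD(3)[OF o(1) w] overD(3)[OF o(2) m] .
  obtain a where a: "match y y' J J' w a a'" using corrD(4)[OF J w w' a'] by blast
  obtain b where b: "b \<in> Hom A y y" "a = Comp A x y y b (FMor F w m g)"
    using mult match_in(1)[OF a corrD(1,2)[OF J]] by blast
  obtain b' where b': "match y y' (Hom A y y) (Hom A' y' y') m b b'"
    using match_exists[of b m y y'] b(1) m m' o(2) by auto
  note hom = C.N.hom_subbimodule[OF obj(1,3)] C'.N.hom_subbimodule[OF obj(2,4)]
    C.N.hom_subbimodule[OF obj(3,3)] C'.N.hom_subbimodule[OF obj(4,4)]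
  have "FMor F w m g \<in> Hom A x y" "FMor F' w m g \<in> Hom A' x' y'"
    using C.mor_in[OF w(1) m(1) g] C'.mor_in[OF w(1) m(1) g] w w' m m' by simp_all
  then have "match y y' (bimodule_product A x y y (Hom A y y) (Hom A x y))
      (bimodule_product A' x' y' y' (Hom A' y' y') (Hom A' x' y')) w
      a (Comp A' x' y' y' b' (FMor F' w m g))"
    unfolding b(2) by (intro match_comp[OF b' m(1) w w' m(2) m' o(2) g] hom)
  then have "match y y' (Hom A x y) (Hom A' x' y') w a (Comp A' x' y' y' b' (FMor F' w m g))"
    using hom obj by (simp add: C.N.product_ide_left C'.N.product_ide_left)
  from match_unique[OF a this w(1) o(2)] have "a' = Comp A' x' y' y' b' (FMor F' w m g)"
    using hom corrD(1,2)[OF J] w w' by simp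
  then show ?thesis using match_in(2)[OF b' hom(3,4)] by blast
qed

text \<open>Every component of \<open>f\<close> is a multiple \<open>b f\<close>. If some
  \<open>b\<close> is a unit, that component generates. If all are radical, their sum gives
  \<open>f = r f\<close> with \<open>r\<close> radical, which forces \<open>f = 0\<close>.\<close>

lemma homogeneous_generator_left:
  assumes o: "ov x x'" "ov y y'" and J: "corr x x' y y' J J'"
    and w: "w \<in> Obj M" "FObj F w = x"
    and f: "f \<in> J" and gen: "\<forall>a\<in>J. \<exists>b\<in>Hom A y y. a = Comp A x y y b f"
  shows "\<exists>m\<in>Obj M. FObj F m = y \<and> (\<exists>g\<in>Hom M w m. FMor F w m g \<in> J \<and> FMor F' w m g \<in> J' \<and>
    (\<forall>a\<in>J. \<exists>b\<in>Hom A y y. a = Comp A x y y b (FMor F w m g)))"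
proof -
  note obj = overD(1,2)[OF o(1)] overD(1,2)[OF o(2)]
  have w': "FObj F' w = x'" using overD(3)[OF o(1) w] .
  have fin: "f \<in> Hom A x y" using f C.N.subbimoduleD(1)[OF corrD(1)[OF J]] by blast
  obtain f' where "match y y' J J' w f f'" using corrD(3)[OF J w w' f] by blast
  then have "(\<exists>m\<in>Obj M. FObj F m = y \<and> (\<exists>g\<in>Hom M w m. FMor F w m g \<in> J \<and> FMor F' w m g \<in> J' \<and>
      (\<exists>e\<in>Hom A y y. f = Comp A x y y e (FMor F w m g)))) \<or>
    (\<exists>r\<in>radical A y y. f = Comp A x y y r f)"
  proof -
    have "(\<exists>m\<in>Obj M. FObj F m = y \<and> (\<exists>g\<in>Hom M w m. FMor F w m g \<in> J \<and> FMor F' w m g \<in> J' \<and>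
        (\<exists>e\<in>Hom A y y. f = Comp A x y y e (FMor F w m g)))) \<or>
      (\<exists>r\<in>radical A y y. a = Comp A x y y r f)" if "match y y' J J' w a a'" for a a'
      using that
    proof induction
      case zero
      have "Comp A x y y 0 f = 0" using obj fin by simp
      then show ?case using C.N.subbimoduleD(2)[OF C.N.radical_subbimodule[OF obj(3)]] by metis
    next
      case (add m h a a')
      obtain b where b: "b \<in> Hom A y y" "FMor F w m h = Comp A x y y b f" using gen add(5) by blast
      show ?case
      proof (cases "invertible A y y b")
        case True
        then obtain e where e: "e \<in> Hom A y y" "Comp A y y y e b = Ide A y" by (auto simp: invertible_def)
        have "f = Comp A x y y e (FMor F w m h)"
          using obj b e fin by (simp add: C.N.comp_assoc[symmetric])
        then show ?thesis using add(1-6) e(1) by blast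
      next
        case False
        then have bR: "b \<in> radical A y y" using b(1) obj by (simp add: C.N.radical_iff)
        show ?thesis
        proof (cases "\<exists>r\<in>radical A y y. a = Comp A x y y r f")
          case True
          then obtain r where r: "r \<in> radical A y y" "a = Comp A x y y r f" by blast
          then have "FMor F w m h + a = Comp A x y y (b + r) f"
            using obj fin b by (simp add: C.N.comp_add C.N.radical_iff)
          then show ?thesis
            using C.N.subbimoduleD(3)[OF C.N.radical_subbimodule[OF obj(3)] bR r(1)] by blast
        qed (use add in blast)
      qed
    qed
    then show "match y y' J J' w f f' \<Longrightarrow> ?thesis" by blast
  qed
  then show ?thesis
  proof
    assume "\<exists>m\<in>Obj M. FObj F m = y \<and> (\<exists>g\<in>Hom M w m. FMor F w m g \<in> J \<and> FMor F' w m g \<in> J' \<and>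
      (\<exists>e\<in>Hom A y y. f = Comp A x y y e (FMor F w m g)))"
    then obtain m g e where m: "m \<in> Obj M" "FObj F m = y" and g: "g \<in> Hom M w m" "FMor F w m g \<in> J"
      "FMor F' w m g \<in> J'" and e: "e \<in> Hom A y y" "f = Comp A x y y e (FMor F w m g)" by blast
    have gin: "FMor F w m g \<in> Hom A x y" using C.mor_in[OF w(1) m(1) g(1)] w m by simp
    have "\<exists>b\<in>Hom A y y. a = Comp A x y y b (FMor F w m g)" if a: "a \<in> J" for a
    proof -
      obtain b where b: "b \<in> Hom A y y" "a = Comp A x y y b f" using gen a by blast
      have "a = Comp A x y y (Comp A y y y b e) (FMor F w m g)"
        unfolding b(2) by (subst e(2)) (use obj b(1) e(1) gin in \<open>simp add: C.N.comp_assoc\<close>)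
      then show ?thesis by (rule bexI) (use obj b(1) e(1) in simp)
    qed
    then show ?thesis using m g by blast
  next
    assume "\<exists>r\<in>radical A y y. f = Comp A x y y r f"
    then obtain r where r: "r \<in> radical A y y" "f = Comp A x y y r f" by blast
    have rin: "r \<in> Hom A y y" "\<not> invertible A y y r" using r(1) obj by (simp_all add: C.N.radical_iff)
    have "invertible A y y (Ide A y - r)"
      using C.N.nonunit_add[of y r "Ide A y - r"] rin obj by auto
    then obtain e where e: "e \<in> Hom A y y" "Comp A y y y e (Ide A y - r) = Ide A y"
      by (auto simp: invertible_def)
    have "f = Comp A x y y e (Comp A x y y (Ide A y - r) f)"
      using obj e fin rin by (simp add: C.N.comp_assoc[symmetric])
    also have "Comp A x y y (Ide A y - r) f = 0"
      using obj fin rin r(2) by (simp add: C.N.comp_diff)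
    finally have f0: "f = 0" using obj e(1) by simp
    \<comment> \<open>Now \<open>f = 0\<close>, and the zero morphism to any object over
      \<open>y\<close> is a homogeneous generator.\<close>
    obtain m where m: "m \<in> Obj M" "FObj F m = y" using C.surj_obj[OF obj(3)] by blast
    have "FMor F w m 0 = f" "FMor F' w m 0 \<in> J'"
      using f0 w m C'.N.subbimoduleD(2)[OF corrD(2)[OF J]] by simp_all
    then show ?thesis using gen f m C.M.zero_in[OF w(1) m(1)] by metis
  qed
qed

text \<open>The same argument with coefficients acting from the right; the components still start in
  \<open>w\<close>.\<close>

lemma homogeneous_generator_right:
  assumes o: "ov x x'" "ov y y'" and J: "corr x x' y y' J J'"
    and w: "w \<in> Obj M" "FObj F w = x"
    and f: "f \<in> J" and gen: "\<forall>a\<in>J. \<exists>b\<in>Hom A x x. a = Comp A x x y f b"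
  shows "\<exists>m\<in>Obj M. FObj F m = y \<and> (\<exists>g\<in>Hom M w m. FMor F w m g \<in> J \<and> FMor F' w m g \<in> J' \<and>
    (\<forall>a\<in>J. \<exists>b\<in>Hom A x x. a = Comp A x x y (FMor F w m g) b))"
proof -
  note obj = overD(1,2)[OF o(1)] overD(1,2)[OF o(2)]
  have w': "FObj F' w = x'" using overD(3)[OF o(1) w] .
  have fin: "f \<in> Hom A x y" using f C.N.subbimoduleD(1)[OF corrD(1)[OF J]] by blast
  obtain f' where "match y y' J J' w f f'" using corrD(3)[OF J w w' f] by blast
  then have "(\<exists>m\<in>Obj M. FObj F m = y \<and> (\<exists>g\<in>Hom M w m. FMor F w m g \<in> J \<and> FMor F' w m g \<in> J' \<and>
      (\<exists>e\<in>Hom A x x. f = Comp A x x y (FMor F w m g) e))) \<or>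
    (\<exists>r\<in>radical A x x. f = Comp A x x y f r)"
  proof -
    have "(\<exists>m\<in>Obj M. FObj F m = y \<and> (\<exists>g\<in>Hom M w m. FMor F w m g \<in> J \<and> FMor F' w m g \<in> J' \<and>
        (\<exists>e\<in>Hom A x x. f = Comp A x x y (FMor F w m g) e))) \<or>
      (\<exists>r\<in>radical A x x. a = Comp A x x y f r)" if "match y y' J J' w a a'" for a a'
      using that
    proof induction
      case zero
      have "Comp A x x y f 0 = 0" using obj fin by simp
      then show ?case using C.N.subbimoduleD(2)[OF C.N.radical_subbimodule[OF obj(1)]] by metis
    next
      case (add m h a a')
      obtain b where b: "b \<in> Hom A x x" "FMor F w m h = Comp A x x y f b" using gen add(5) by blast
      show ?case
      proof (cases "invertible A x x b")
        case True
        then obtain e where e: "e \<in> Hom A x x" "Comp A x x x b e = Ide A x" by (auto simp: invertible_def)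
        have "f = Comp A x x y (FMor F w m h) e"
          using obj b e fin by (simp add: C.N.comp_assoc)
        then show ?thesis using add(1-6) e(1) by blast
      next
        case False
        then have bR: "b \<in> radical A x x" using b(1) obj by (simp add: C.N.radical_iff)
        show ?thesis
        proof (cases "\<exists>r\<in>radical A x x. a = Comp A x x y f r")
          case True
          then obtain r where r: "r \<in> radical A x x" "a = Comp A x x y f r" by blast
          then have "FMor F w m h + a = Comp A x x y f (b + r)"
            using obj fin b by (simp add: C.N.comp_add C.N.radical_iff)
          then show ?thesis
            using C.N.subbimoduleD(3)[OF C.N.radical_subbimodule[OF obj(1)] bR r(1)] by blast
        qed (use add in blast)
      qed
    qed
    then show "match y y' J J' w f f' \<Longrightarrow> ?thesis" by blast
  qed
  then show ?thesis
  proof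
    assume "\<exists>m\<in>Obj M. FObj F m = y \<and> (\<exists>g\<in>Hom M w m. FMor F w m g \<in> J \<and> FMor F' w m g \<in> J' \<and>
      (\<exists>e\<in>Hom A x x. f = Comp A x x y (FMor F w m g) e))"
    then obtain m g e where m: "m \<in> Obj M" "FObj F m = y" and g: "g \<in> Hom M w m" "FMor F w m g \<in> J"
      "FMor F' w m g \<in> J'" and e: "e \<in> Hom A x x" "f = Comp A x x y (FMor F w m g) e" by blast
    have gin: "FMor F w m g \<in> Hom A x y" using C.mor_in[OF w(1) m(1) g(1)] w m by simp
    have "\<exists>b\<in>Hom A x x. a = Comp A x x y (FMor F w m g) b" if a: "a \<in> J" for a
    proof -
      obtain b where b: "b \<in> Hom A x x" "a = Comp A x x y f b" using gen a by blast
      have "a = Comp A x x y (FMor F w m g) (Comp A x x x e b)"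
        unfolding b(2) by (subst e(2)) (use obj b(1) e(1) gin in \<open>simp add: C.N.comp_assoc\<close>)
      then show ?thesis by (rule bexI) (use obj b(1) e(1) in simp)
    qed
    then show ?thesis using m g by blast
  next
    assume "\<exists>r\<in>radical A x x. f = Comp A x x y f r"
    then obtain r where r: "r \<in> radical A x x" "f = Comp A x x y f r" by blast
    have rin: "r \<in> Hom A x x" "\<not> invertible A x x r" using r(1) obj by (simp_all add: C.N.radical_iff)
    have "invertible A x x (Ide A x - r)"
      using C.N.nonunit_add[of x r "Ide A x - r"] rin obj by auto
    then obtain e where e: "e \<in> Hom A x x" "Comp A x x x (Ide A x - r) e = Ide A x"
      by (auto simp: invertible_def)
    have "f = Comp A x x y (Comp A x x y f (Ide A x - r)) e"
      using obj e fin rin by (simp add: C.N.comp_assoc)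
    also have "Comp A x x y f (Ide A x - r) = 0"
      using obj fin rin r(2) by (simp add: C.N.comp_diff)
    finally have f0: "f = 0" using obj e(1) by simp
    obtain m where m: "m \<in> Obj M" "FObj F m = y" using C.surj_obj[OF obj(3)] by blast
    have "FMor F w m 0 = f" "FMor F' w m 0 \<in> J'"
      using f0 w m C'.N.subbimoduleD(2)[OF corrD(2)[OF J]] by simp_all
    then show ?thesis using gen f m C.M.zero_in[OF w(1) m(1)] by metis
  qed
qed

end

section \<open>Transfer of distributivity and regularity\<close>

primrec radical_power :: "('k::field, 'o, 'm::ab_group_add) kcategory \<Rightarrow> 'o \<Rightarrow> nat \<Rightarrow> 'm set" where
  "radical_power A x 0 = Hom A x x"
| "radical_power A x (Suc i) = bimodule_product A x x x (radical A x x) (radical_power A x i)"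

context lb_cat
begin

lemma radical_power_subbimodule: "x \<in> Obj A \<Longrightarrow> subbimodule A x x (radical_power A x i)"
  by (induction i) (simp_all add: hom_subbimodule product_subbimodule radical_subbimodule)

lemma endo_power_in_radical_power:
  assumes "x \<in> Obj A" "t \<in> radical A x x"
  shows "endo_power x t i \<in> radical_power A x i"
proof (induction i)
  case (Suc i)
  show ?case
    unfolding endo_power.simps radical_power.simps
    by (intro product_in assms radical_subbimodule radical_power_subbimodule Suc)
qed (use assms in simp)

context
  fixes x t n
  assumes x: "x \<in> Obj A" and us: "uniserial x t n"
begin

lemma uniserial_generator: "t \<in> radical A x x"
  using nilpotent_nonunit[OF x] uniserialD(1,2)[OF x us] x by (simp add: radical_iff)

lemma radical_power_generated:
  "a \<in> radical_power A x i \<Longrightarrow> \<exists>b\<in>Hom A x x. a = Comp A x x x (endo_power x t i) b"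
proof (induction i arbitrary: a)
  case 0
  then show ?case using x by (intro bexI[of _ a]) simp_all
next
  case (Suc i)
  then obtain j where j: "j \<in> radical_power A x i" "a = Comp A x x x t j"
    using product_radical_left[OF x us x radical_power_subbimodule[OF x] Suc.prems[unfolded radical_power.simps]]
    by blast
  then obtain b where b: "b \<in> Hom A x x" "j = Comp A x x x (endo_power x t i) b" using Suc.IH by blast
  then have "a = Comp A x x x (endo_power x t (Suc i)) b"
    using j x uniserialD(1)[OF x us] by (simp add: comp_assoc)
  then show ?case using b by blast
qed

lemma radical_power_nilpotent: "radical_power A x n \<subseteq> {0}"
  using radical_power_generated[of _ n] uniserialD(2)[OF x us] x by fastforce

text \<open>One step down the chain generated by the elements \<open>f t^i\<close> is multiplication
  by the radical, an operation that preserves correspondence. That \<open>Q i\<close> is closed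
  under the left action has to be assumed; \<open>corr_exists\<close> obtains it
  inductively.\<close>

lemma cyclic_right_radical:
  assumes y: "y \<in> Obj A" and f: "f \<in> Hom A x y"
    and Q: "Q i = (\<lambda>a. Comp A x x y (Comp A x x y f (endo_power x t i)) a) ` Hom A x x"
      "Q (Suc i) = (\<lambda>a. Comp A x x y (Comp A x x y f (endo_power x t (Suc i))) a) ` Hom A x x"
    and sub: "subbimodule A x y (Q i)"
  shows "Q (Suc i) = bimodule_product A x x y (Q i) (radical A x x)"
proof (intro equalityI subsetI)
  note t = uniserialD(1)[OF x us]
  have comm: "Comp A x x x (endo_power x t i) (Comp A x x x a t) =
      Comp A x x x (endo_power x t (Suc i)) a" if a: "a \<in> Hom A x x" for a
  proof -
    have "Comp A x x x (endo_power x t (Suc i)) a = Comp A x x x (endo_power x t i) (Comp A x x x t a)"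
      unfolding endo_power_Suc_right[OF x t] using x t a by (simp add: comp_assoc)
    then show ?thesis using uniserialD(3)[OF x us t a] by simp
  qed
  have gi: "Comp A x x y f (endo_power x t i) \<in> Q i"
    unfolding Q using x y f t by (auto intro!: image_eqI[of _ _ "Ide A x"])
  fix a
  {
    assume "a \<in> Q (Suc i)"
    then obtain b where b: "b \<in> Hom A x x" "a = Comp A x x y (Comp A x x y f (endo_power x t (Suc i))) b"
      unfolding Q by blast
    have "a = Comp A x x y (Comp A x x y f (endo_power x t i)) (Comp A x x x b t)"
      using x y f t b comm[OF b(1)] by (simp add: comp_assoc del: endo_power.simps)
    moreover have "Comp A x x x b t \<in> radical A x x"
      using uniserial_generator x b by (simp add: radical_iff unit_comp_iff)
    ultimately show "a \<in> bimodule_product A x x y (Q i) (radical A x x)"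
      using product_in[OF x x y radical_subbimodule[OF x] sub gi] by simp
  next
    assume "a \<in> bimodule_product A x x y (Q i) (radical A x x)"
    then obtain j where j: "j \<in> Q i" "a = Comp A x x y j t"
      using product_radical_right[OF x us y sub] by blast
    then obtain b where b: "b \<in> Hom A x x" "j = Comp A x x y (Comp A x x y f (endo_power x t i)) b"
      unfolding Q by blast
    have "a = Comp A x x y (Comp A x x y f (endo_power x t (Suc i))) b"
      using x y f t b j comm[OF b(1)] by (simp add: comp_assoc del: endo_power.simps)
    then show "a \<in> Q (Suc i)" unfolding Q using b by blast
  }
qed

lemma cyclic_left_radical:
  assumes w: "w \<in> Obj A" and f: "f \<in> Hom A w x"
    and Q: "Q i = (\<lambda>b. Comp A w x x b (Comp A w x x (endo_power x t i) f)) ` Hom A x x"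
      "Q (Suc i) = (\<lambda>b. Comp A w x x b (Comp A w x x (endo_power x t (Suc i)) f)) ` Hom A x x"
    and sub: "subbimodule A w x (Q i)"
  shows "Q (Suc i) = bimodule_product A w x x (radical A x x) (Q i)"
proof (intro equalityI subsetI)
  note t = uniserialD(1)[OF x us]
  have comm: "Comp A x x x (Comp A x x x t b) (endo_power x t i) =
      Comp A x x x b (endo_power x t (Suc i))" if b: "b \<in> Hom A x x" for b
    using x t b uniserialD(3)[OF x us t b] by (simp add: comp_assoc)
  have gi: "Comp A w x x (endo_power x t i) f \<in> Q i"
    unfolding Q using x w f t by (auto intro!: image_eqI[of _ _ "Ide A x"])
  fix a
  {
    assume "a \<in> Q (Suc i)"
    then obtain b where b: "b \<in> Hom A x x" "a = Comp A w x x b (Comp A w x x (endo_power x t (Suc i)) f)"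
      unfolding Q by blast
    have "a = Comp A w x x (Comp A x x x t b) (Comp A w x x (endo_power x t i) f)"
      using x w f t b comm[OF b(1)] by (simp add: comp_assoc[symmetric] del: endo_power.simps)
    moreover have "Comp A x x x t b \<in> radical A x x"
      using uniserial_generator x b by (simp add: radical_iff unit_comp_iff)
    ultimately show "a \<in> bimodule_product A w x x (radical A x x) (Q i)"
      using product_in[OF w x x sub radical_subbimodule[OF x] _ gi] by simp
  next
    assume "a \<in> bimodule_product A w x x (radical A x x) (Q i)"
    then obtain j where j: "j \<in> Q i" "a = Comp A w x x t j"
      using product_radical_left[OF x us w sub] by blast
    then obtain b where b: "b \<in> Hom A x x" "j = Comp A w x x b (Comp A w x x (endo_power x t i) f)"
      unfolding Q by blast
    have "a = Comp A w x x b (Comp A w x x (endo_power x t (Suc i)) f)"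
      using x w f t b j comm[OF b(1)] by (simp add: comp_assoc[symmetric] del: endo_power.simps)
    then show "a \<in> Q (Suc i)" unfolding Q using b by blast
  }
qed

end

end

context covering_pair
begin

lemma corr_radical_power:
  assumes "ov x x'"
  shows "corr x x' x x' (radical_power A x i) (radical_power A' x' i)"
  by (induction i) (simp_all add: corr_hom corr_radical corr_product assms)

text \<open>The new generator \<open>t'\<close> is \<open>F' g\<close> for a homogeneous generator
  \<open>F g\<close> of the radical of \<open>A(x,x)\<close>; the two hypotheses of
  \<open>truncated_polynomialI\<close> are then checked by lifting.\<close>

lemma truncated_transfer:
  assumes o: "ov x x'" and trunc: "endomorphisms_truncated_polynomial A x n"
  shows "\<exists>n. endomorphisms_truncated_polynomial A' x' n"
proof -
  note obj = overD(1,2)[OF o]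
  obtain u where u: "u \<in> Obj M" "FObj F u = x" "FObj F' u = x'" using o by (auto simp: over_def)
  obtain t where us: "C.N.uniserial x t n" using C.N.truncated_polynomial_uniserial[OF obj(1) trunc] by blast
  note t = C.N.uniserialD(1)[OF obj(1) us]
  \<comment> \<open>Left multiples are required, so commutativity turns \<open>t b\<close> into
    \<open>b t\<close>.\<close>
  have "\<forall>a\<in>radical A x x. \<exists>b\<in>Hom A x x. a = Comp A x x x b t"
    unfolding C.N.uniserial_radical[OF obj(1) us] using C.N.uniserialD(3)[OF obj(1) us t] by auto
  from homogeneous_generator_left[OF o o corr_radical[OF o] u(1,2) C.N.uniserial_generator[OF obj(1) us] this]
  obtain m g where m: "m \<in> Obj M" "FObj F m = x" and g: "g \<in> Hom M u m"
    and g': "FMor F' u m g \<in> radical A' x' x'"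
    and gen: "\<forall>a\<in>radical A x x. \<exists>b\<in>Hom A x x. a = Comp A x x x b (FMor F u m g)" by blast
  define t' where "t' = FMor F' u m g"
  have t': "t' \<in> Hom A' x' x'" using g' obj by (simp add: C'.N.radical_iff t'_def)
  have gen': "\<exists>b'\<in>Hom A' x' x'. r' = Comp A' x' x' x' b' t'" if "r' \<in> radical A' x' x'" for r'
    unfolding t'_def by (rule corr_left_multiple[OF o o corr_radical[OF o] u(1,2) m g gen that])
  \<comment> \<open>Lifting is not multiplicative, so nilpotency of \<open>t\<close> gives nothing
    directly for \<open>t'\<close>. But \<open>t'^n\<close> lies in the \<open>n\<close>-th radical
    power, whose counterpart in \<open>A\<close> is zero.\<close>
  have nil: "C'.N.endo_power x' t' n = 0"
  proof -
    have "C'.N.endo_power x' t' n \<in> radical_power A' x' n"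
      using C'.N.endo_power_in_radical_power[OF obj(2)] g' by (simp add: t'_def)
    then obtain a where a: "match x x' (radical_power A x n) (radical_power A' x' n) u a (C'.N.endo_power x' t' n)"
      using corrD(4)[OF corr_radical_power[OF o] u] by blast
    then have "a = 0"
      using match_in(1)[OF a corrD(1,2)[OF corr_radical_power[OF o]]]
        C.N.radical_power_nilpotent[OF obj(1) us] by blast
    then show ?thesis using match_zero[of x x' _ _ u] a u obj by simp
  qed
  show ?thesis
  proof (rule C'.N.truncated_polynomialI[OF obj(2) t' nil])
    fix a' assume a': "a' \<in> Hom A' x' x'"
    let ?H = "Hom A x x" and ?H' = "Hom A' x' x'"
    obtain a where a: "match x x' ?H ?H' u a a'" using corrD(4)[OF corr_hom[OF o o] u a'] by blast
    then have "a \<in> ?H" using match_in(1)[OF a corrD(1,2)[OF corr_hom[OF o o]]] by blast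
    \<comment> \<open>The scalar part is the image of a multiple of the identity of \<open>u\<close>
      under both functors, so lifting preserves it. Only the radical part has to be
      controlled.\<close>
    then obtain c b where b: "b \<in> ?H" "a = Scale A c (Ide A x) + Comp A x x x t b"
      using C.N.uniserialD(4)[OF obj(1) us] by blast
    have "Comp A x x x t b \<in> radical A x x" using C.N.uniserial_radical[OF obj(1) us] b(1) by blast
    then obtain r' where r': "match x x' (radical A x x) (radical A' x' x') u (Comp A x x x t b) r'"
      using corrD(3)[OF corr_radical[OF o] u] by blast
    have "r' \<in> radical A' x' x'" using match_in(2)[OF r' corrD(1,2)[OF corr_radical[OF o]]] .
    then obtain b' where b': "b' \<in> ?H'" "r' = Comp A' x' x' x' b' t'" using gen' by blast
    have "match x x' ?H ?H' u (Comp A x x x t b) r'"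
      by (rule matched_mono[OF r']) (use obj in \<open>auto simp: C.N.radical_iff C'.N.radical_iff\<close>)
    moreover have "FMor F u u (Scale M c (Ide M u)) = Scale A c (Ide A x)"
      "FMor F' u u (Scale M c (Ide M u)) = Scale A' c (Ide A' x')"
      using u by simp_all
    ultimately have "match x x' ?H ?H' u a (Scale A' c (Ide A' x') + r')"
      unfolding b(2) using matched.add[of u M F x F' x' "Scale M c (Ide M u)" u ?H ?H'] u obj by simp
    then have "a' = Scale A' c (Ide A' x') + r'"
      using match_unique[OF a _ u(1) o] corrD(1,2)[OF corr_hom[OF o o]] u by simp
    then show "\<exists>c. \<exists>b\<in>?H'. a' = Scale A' c (Ide A' x') + Comp A' x' x' x' b t'"
      using b' by blast
  qed
qed

lemma cyclic_left_transfer: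
  assumes o: "ov x x'" "ov y y'" and cyc: "cyclic_left A x y"
  shows "cyclic_left A' x' y'"
proof -
  note obj = overD(1,2)[OF o(1)] overD(1,2)[OF o(2)]
  obtain u where u: "u \<in> Obj M" "FObj F u = x" "FObj F' u = x'" using o by (auto simp: over_def)
  obtain f where f: "f \<in> Hom A x y" "Hom A x y = (\<lambda>b. Comp A x y y b f) ` Hom A y y"
    using cyc by (auto simp: cyclic_left_def)
  then have "\<forall>a\<in>Hom A x y. \<exists>b\<in>Hom A y y. a = Comp A x y y b f" by blast
  from homogeneous_generator_left[OF o corr_hom[OF o] u(1,2) f(1) this]
  obtain m g where m: "m \<in> Obj M" "FObj F m = y" and g: "g \<in> Hom M u m"
    and g': "FMor F' u m g \<in> Hom A' x' y'"
    and gen: "\<forall>a\<in>Hom A x y. \<exists>b\<in>Hom A y y. a = Comp A x y y b (FMor F u m g)" by blast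
  have "Hom A' x' y' \<subseteq> (\<lambda>b. Comp A' x' y' y' b (FMor F' u m g)) ` Hom A' y' y'"
    using corr_left_multiple[OF o corr_hom[OF o] u(1,2) m g gen] by blast
  then show ?thesis
    unfolding cyclic_left_def using g' obj by (intro bexI[OF _ g']) auto
qed

text \<open>With \<open>b = c + r\<close> the multiple \<open>F g \<cdot> b\<close> lifts to
  \<open>c\<close> times \<open>F' g\<close> plus an error in the product of
  \<open>A'(x',y')\<close> with the radical. So \<open>F' g\<close> generates modulo this product,
  and nilpotency of the radical of \<open>A'(x',x')\<close> removes the error.\<close>

lemma cyclic_right_transfer:
  assumes o: "ov x x'" "ov y y'" and cyc: "cyclic_right A x y"
    and us: "C.N.uniserial x t n" and us': "C'.N.uniserial x' t' n'"
  shows "cyclic_right A' x' y'"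
proof -
  note obj = overD(1,2)[OF o(1)] overD(1,2)[OF o(2)]
  let ?H = "Hom A x y" and ?H' = "Hom A' x' y'"
  let ?HR = "bimodule_product A x x y ?H (radical A x x)"
  let ?HR' = "bimodule_product A' x' x' y' ?H' (radical A' x' x')"
  note hom = corrD(1,2)[OF corr_hom[OF o]] and t' = C'.N.uniserialD(1)[OF obj(2) us']
  have HR: "corr x x' y y' ?HR ?HR'"
    by (rule corr_product[OF o(1,1,2) corr_radical[OF o(1)] corr_hom[OF o]])
  obtain u where u: "u \<in> Obj M" "FObj F u = x" "FObj F' u = x'" using o by (auto simp: over_def)
  obtain f where f: "f \<in> ?H" "?H = (\<lambda>b. Comp A x x y f b) ` Hom A x x"
    using cyc by (auto simp: cyclic_right_def)
  then have "\<forall>a\<in>?H. \<exists>b\<in>Hom A x x. a = Comp A x x y f b" by blast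
  from homogeneous_generator_right[OF o corr_hom[OF o] u(1,2) f(1) this]
  obtain m g where m: "m \<in> Obj M" "FObj F m = y" and g: "g \<in> Hom M u m"
    and Fg: "FMor F u m g \<in> ?H" and Fg': "FMor F' u m g \<in> ?H'"
    and gen: "\<forall>a\<in>?H. \<exists>b\<in>Hom A x x. a = Comp A x x y (FMor F u m g) b" by blast
  have m': "FObj F' m = y'" using overD(3)[OF o(2) m] .
  let ?g = "FMor F u m g" and ?g' = "FMor F' u m g"
  have step: "\<exists>c. \<exists>b'\<in>?H'. a' = Scale A' c ?g' + Comp A' x' x' y' b' t'" if a': "a' \<in> ?H'" for a'
  proof -
    obtain a where a: "match y y' ?H ?H' u a a'" using corrD(4)[OF corr_hom[OF o] u a'] by blast
    obtain b where b: "b \<in> Hom A x x" "a = Comp A x x y ?g b"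
      using gen match_in(1)[OF a hom] by blast
    obtain c b1 where b1: "b1 \<in> Hom A x x" "b = Scale A c (Ide A x) + Comp A x x x t b1"
      using C.N.uniserialD(4)[OF obj(1) us b(1)] by blast
    let ?r = "Comp A x x x t b1"
    have r: "?r \<in> radical A x x" using C.N.uniserial_radical[OF obj(1) us] b1(1) by blast
    have rin: "?r \<in> Hom A x x" using r obj by (simp add: C.N.radical_iff)
    have a_eq: "a = Scale A c ?g + Comp A x x y ?g ?r"
      unfolding b(2) b1(2) using obj Fg rin by (simp add: C.N.comp_add)
    have "Comp A x x y ?g ?r \<in> ?HR"
      by (rule C.N.product_in[OF obj(1,1,3) C.N.radical_subbimodule[OF obj(1)] hom(1) Fg r])
    then obtain e' where e': "match y y' ?HR ?HR' u (Comp A x x y ?g ?r) e'"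
      using corrD(3)[OF HR u] by blast
    have e'_in: "e' \<in> ?HR'" using match_in(2)[OF e' corrD(1,2)[OF HR]] .
    have cg: "FMor F u m (Scale M c g) = Scale A c ?g" "FMor F' u m (Scale M c g) = Scale A' c ?g'"
      using u m g by simp_all
    have "match y y' ?H ?H' u (Comp A x x y ?g ?r) e'"
      by (rule matched_mono[OF e'])
        (use C.N.subbimoduleD(1)[OF corrD(1)[OF HR]] C'.N.subbimoduleD(1)[OF corrD(2)[OF HR]] in blast)+
    then have "match y y' ?H ?H' u a (Scale A' c ?g' + e')"
      unfolding a_eq using matched.add[of m M F y F' y' "Scale M c g" u ?H ?H'] u m m' g Fg Fg' obj
      by (simp add: cg)
    then have "a' = Scale A' c ?g' + e'"
      using match_unique[OF a _ u(1) o(2)] hom u by simp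
    then show ?thesis
      using C'.N.product_radical_right[OF obj(2) us' obj(4) hom(2) e'_in] by blast
  qed
  \<comment> \<open>Substituting \<open>step\<close> into its own remainder gains one power of
    \<open>t'\<close> each time; at \<open>i = n'\<close> the remainder is zero.\<close>
  have "\<exists>r\<in>Hom A' x' x'. \<exists>b\<in>?H'. a' = Comp A' x' x' y' ?g' r + Comp A' x' x' y' b (C'.N.endo_power x' t' i)"
    if a': "a' \<in> ?H'" for a' i
  proof (induction i)
    case 0
    show ?case using a' Fg' obj by (intro bexI[of _ 0] bexI[of _ a']) simp_all
  next
    case (Suc i)
    then obtain r b where r: "r \<in> Hom A' x' x'" and b: "b \<in> ?H'"
      and eq: "a' = Comp A' x' x' y' ?g' r + Comp A' x' x' y' b (C'.N.endo_power x' t' i)" by blast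
    obtain c b1 where b1: "b1 \<in> ?H'" "b = Scale A' c ?g' + Comp A' x' x' y' b1 t'" using step[OF b] by blast
    have "a' = Comp A' x' x' y' ?g' (r + Scale A' c (C'.N.endo_power x' t' i)) +
        Comp A' x' x' y' b1 (C'.N.endo_power x' t' (Suc i))"
      unfolding eq b1(2) using obj r b1(1) Fg' t' by (simp add: C'.N.comp_add C'.N.comp_assoc add.assoc)
    moreover have "r + Scale A' c (C'.N.endo_power x' t' i) \<in> Hom A' x' x'" using r obj t' by simp
    ultimately show ?case using b1(1) by blast
  qed
  from this[of _ n'] have "?H' \<subseteq> (\<lambda>a. Comp A' x' x' y' ?g' a) ` Hom A' x' x'"
    using C'.N.uniserialD(2)[OF obj(2) us'] obj by fastforce
  then show ?thesis
    unfolding cyclic_right_def using obj by (intro bexI[OF _ Fg']) (auto simp: Fg')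
qed

lemma over_exists: "x' \<in> Obj A' \<Longrightarrow> \<exists>x. ov x x'"
  using C'.surj_obj[of x'] by (auto simp: over_def)

lemma distributive_transfer:
  assumes dist: "distributive A"
  shows "distributive A'"
proof -
  \<comment> \<open>Endomorphism rings come first, because the transfer of right cyclicity needs the
    nilpotent generator on the side of \<open>A'\<close>.\<close>
  have trunc: "\<exists>n. endomorphisms_truncated_polynomial A' x' n" if "ov x x'" for x x'
    using truncated_transfer[OF that] dist overD(1)[OF that] unfolding distributive_def by blast
  have "cyclic_right A' x' y' \<or> cyclic_left A' x' y'" if o: "ov x x'" "ov y y'" for x x' y y'
  proof -
    obtain t n where us: "C.N.uniserial x t n"
      using C.N.truncated_polynomial_uniserial[OF overD(1)[OF o(1)]] dist overD(1)[OF o(1)]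
      unfolding distributive_def by blast
    obtain t' n' where us': "C'.N.uniserial x' t' n'"
      using C'.N.truncated_polynomial_uniserial[OF overD(2)[OF o(1)]] trunc[OF o(1)] by blast
    have "cyclic_right A x y \<or> cyclic_left A x y"
      using dist overD(1)[OF o(1)] overD(1)[OF o(2)] unfolding distributive_def by blast
    then show ?thesis using cyclic_left_transfer[OF o] cyclic_right_transfer[OF o _ us us'] by blast
  qed
  then show ?thesis unfolding distributive_def using trunc over_exists by metis
qed

lemma regular_transfer:
  assumes reg: "regular A"
  shows "regular A'"
proof -
  have dist: "distributive A" using reg by (simp add: regular_def)
  have dist': "distributive A'" by (rule distributive_transfer[OF dist])
  have "cyclic_right A' x' y' \<and> cyclic_left A' x' y'" if o: "ov x x'" "ov y y'" for x x' y y'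
  proof -
    obtain t n where us: "C.N.uniserial x t n"
      using C.N.truncated_polynomial_uniserial[OF overD(1)[OF o(1)]] dist overD(1)[OF o(1)]
      unfolding distributive_def by blast
    obtain t' n' where us': "C'.N.uniserial x' t' n'"
      using C'.N.truncated_polynomial_uniserial[OF overD(2)[OF o(1)]] dist' overD(2)[OF o(1)]
      unfolding distributive_def by blast
    have "cyclic_right A x y \<and> cyclic_left A x y"
      using reg overD(1)[OF o(1)] overD(1)[OF o(2)] unfolding regular_def by blast
    then show ?thesis using cyclic_left_transfer[OF o] cyclic_right_transfer[OF o _ us us'] by blast
  qed
  then show ?thesis unfolding regular_def using dist' over_exists by metis
qed

lemma corr_exists:
  assumes dist: "distributive A" and o: "ov x x'" "ov y y'" and J: "subbimodule A x y J"
  shows "\<exists>J'. corr x x' y y' J J'"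
proof -
  interpret D: dist_cat A by unfold_locales (rule dist)
  note obj = overD(1)[OF o(1)] overD(1)[OF o(2)]
  consider "cyclic_right A x y" | "cyclic_left A x y"
    using dist obj unfolding distributive_def by blast
  then show ?thesis
  proof cases
    case 1
    then obtain f where f: "f \<in> Hom A x y" "Hom A x y = (\<lambda>a. Comp A x x y f a) ` Hom A x x"
      unfolding cyclic_right_def by blast
    obtain t n where us: "C.N.uniserial x t n" using D.obtain_uniserial[OF obj(1)] .
    \<comment> \<open>Every subbimodule is some \<open>Q i\<close> by
      \<open>subbimodule_cyclic_right\<close>, so it suffices to follow this chain from the whole
      hom-space downwards.\<close>
    define Q where "Q i = (\<lambda>a. Comp A x x y (Comp A x x y f (C.N.endo_power x t i)) a) ` Hom A x x" for i
    have "\<exists>J'. corr x x' y y' (Q i) J'" for i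
    proof (induction i)
      case 0
      have "Q 0 = Hom A x y" using f obj by (simp add: Q_def)
      then show ?case using corr_hom[OF o] by auto
    next
      case (Suc i)
      then obtain J' where J': "corr x x' y y' (Q i) J'" by blast
      have "Q (Suc i) = bimodule_product A x x y (Q i) (radical A x x)"
        by (rule C.N.cyclic_right_radical[OF obj(1) us obj(2) f(1) Q_def Q_def corrD(1)[OF J']])
      then show ?case using corr_product[OF o(1,1,2) corr_radical[OF o(1)] J'] by auto
    qed
    then show ?thesis
      using C.N.subbimodule_cyclic_right[OF obj(1) us obj(2) f J] unfolding Q_def by metis
  next
    case 2
    then obtain f where f: "f \<in> Hom A x y" "Hom A x y = (\<lambda>b. Comp A x y y b f) ` Hom A y y"
      unfolding cyclic_left_def by blast
    obtain t n where us: "C.N.uniserial y t n" using D.obtain_uniserial[OF obj(2)] .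
    define Q where "Q i = (\<lambda>b. Comp A x y y b (Comp A x y y (C.N.endo_power y t i) f)) ` Hom A y y" for i
    have "\<exists>J'. corr x x' y y' (Q i) J'" for i
    proof (induction i)
      case 0
      have "Q 0 = Hom A x y" using f obj by (simp add: Q_def)
      then show ?case using corr_hom[OF o] by auto
    next
      case (Suc i)
      then obtain J' where J': "corr x x' y y' (Q i) J'" by blast
      have "Q (Suc i) = bimodule_product A x y y (radical A y y) (Q i)"
        by (rule C.N.cyclic_left_radical[OF obj(2) us obj(1) f(1) Q_def Q_def corrD(1)[OF J']])
      then show ?case using corr_product[OF o(1,2,2) J' corr_radical[OF o(2)]] by auto
    qed
    then show ?thesis
      using C.N.subbimodule_cyclic_left[OF obj(2) us obj(1) f J] unfolding Q_def by metis
  qed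
qed

end

section \<open>The isomorphism of stem categories and of ray categories\<close>

text \<open>For covering functors with equal fibres both choices are forced, by
  \<open>over_unique\<close> and \<open>corr_unique\<close>; in a distributive category the objects
  of choice exist.\<close>

definition transport ::
  "('k::field, 'o, 'm::ab_group_add) kcategory \<Rightarrow> ('k, 'p, 'n::ab_group_add) kcategory \<Rightarrow>
     ('k, 'q, 'l::ab_group_add) kcategory \<Rightarrow> ('o, 'm, 'p, 'n) cat_functor \<Rightarrow>
     ('o, 'm, 'q, 'l) cat_functor \<Rightarrow> ('p, 'n set, 'q, 'l set) cat_functor"
where
  "transport M A A' F F' =
     \<lparr>FObj = (\<lambda>x. SOME x'. over M F F' x x'),
      FMor = (\<lambda>x y J. SOME J'. corresponding M A A' F F'
        x (SOME x'. over M F F' x x') y (SOME y'. over M F F' y y') J J')\<rparr>"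

context covering_pair
begin

abbreviation "T \<equiv> transport M A A' F F'"

lemma over_unique:
  assumes "ov x x'" "ov x x''"
  shows "x' = x''"
proof -
  obtain u where u: "u \<in> Obj M" "FObj F u = x" "FObj F' u = x''" using assms(2) unfolding over_def by blast
  then show ?thesis using overD(3)[OF assms(1) u(1,2)] by simp
qed

lemma over_transport:
  assumes "x \<in> Obj A"
  shows "ov x (FObj T x)"
proof -
  have "\<exists>x'. ov x x'" using C.surj_obj[OF assms] by (auto simp: over_def)
  then show ?thesis unfolding transport_def cat_functor.simps by (rule someI_ex)
qed

lemma corr_transport:
  assumes "distributive A" "x \<in> Obj A" "y \<in> Obj A" "subbimodule A x y J"
  shows "corr x (FObj T x) y (FObj T y) J (FMor T x y J)"
  using someI_ex[OF corr_exists[OF assms(1) over_transport[OF assms(2)] over_transport[OF assms(3)] assms(4)]]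
  by (simp add: transport_def)

text \<open>Reduces each functor law to exhibiting a corresponding pair, by uniqueness of the
  counterpart.\<close>

lemma transport_eqI:
  assumes "distributive A" "x \<in> Obj A" "y \<in> Obj A" "corr x (FObj T x) y (FObj T y) J J'"
  shows "FMor T x y J = J'"
  using assms corr_unique[OF over_transport over_transport corr_transport] corrD(1) by metis

lemma corr_eq_iff:
  assumes "ov x x'" "ov y y'" "corr x x' y y' J J'" "corr x x' y y' K K'"
  shows "J = K \<longleftrightarrow> J' = K'"
  using assms corr_unique corr_unique_left by metis

text \<open>The case distinction in the ray product only asks whether certain subbimodules coincide.
  Correspondence is injective in both directions, so the answer is the same in \<open>A\<close> and
  in \<open>A'\<close>.\<close>

lemma corr_ray_product:
  assumes o: "ov x x'" "ov y y'" "ov z z'"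
    and J: "corr x x' y y' J J'" and K: "corr y y' z z' K K'"
  shows "corr x x' z z' (ray_product A x y z K J) (ray_product A' x' y' z' K' J')"
proof -
  note KJ = corr_product[OF o J K]
    and KNJ = corr_product[OF o J corr_product[OF o(2,2,3) corr_radical[OF o(2)] K]]
  show ?thesis
    unfolding ray_product_def corr_eq_iff[OF o(1,3) KNJ KJ] corr_eq_iff[OF o(1,3) KJ corr_zero[OF o(1,3)]]
    using KJ corr_zero[OF o(1,3)] by simp
qed

lemma transport_stem_functor:
  assumes "distributive A"
  shows "is_functor (stem_category A) (stem_category A') T"
  unfolding is_functor_def stem_category_def
proof (simp, intro conjI ballI allI impI)
  fix x assume x: "x \<in> Obj A"
  note o = over_transport[OF x]
  show "FObj T x \<in> Obj A'" by (rule overD(2)[OF o])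
  show "FMor T x x (Hom A x x) = Hom A' (FObj T x) (FObj T x)"
    by (rule transport_eqI[OF assms x x corr_hom[OF o o]])
  fix y assume y: "y \<in> Obj A"
  note o' = over_transport[OF y]
  show "subbimodule A' (FObj T x) (FObj T y) (FMor T x y J)" if "subbimodule A x y J" for J
    by (rule corrD(2)[OF corr_transport[OF assms x y that]])
  fix z J K assume z: "z \<in> Obj A" and J: "subbimodule A x y J" and K: "subbimodule A y z K"
  show "FMor T x z (bimodule_product A x y z K J) =
      bimodule_product A' (FObj T x) (FObj T y) (FObj T z) (FMor T y z K) (FMor T x y J)"
    by (rule transport_eqI[OF assms x z corr_product[OF o o' over_transport[OF z]
          corr_transport[OF assms x y J] corr_transport[OF assms y z K]]])
qed

lemma transport_ray_functor:
  assumes "distributive A"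
  shows "is_functor (ray_category A) (ray_category A') T"
  unfolding is_functor_def ray_category_def
proof (simp, intro conjI ballI allI impI)
  fix x assume x: "x \<in> Obj A"
  note o = over_transport[OF x]
  show "FObj T x \<in> Obj A'" by (rule overD(2)[OF o])
  show "FMor T x x (Hom A x x) = Hom A' (FObj T x) (FObj T x)"
    by (rule transport_eqI[OF assms x x corr_hom[OF o o]])
  fix y assume y: "y \<in> Obj A"
  note o' = over_transport[OF y]
  show "subbimodule A' (FObj T x) (FObj T y) (FMor T x y J)" if "subbimodule A x y J" for J
    by (rule corrD(2)[OF corr_transport[OF assms x y that]])
  fix z J K assume z: "z \<in> Obj A" and J: "subbimodule A x y J" and K: "subbimodule A y z K"
  show "FMor T x z (ray_product A x y z K J) =
      ray_product A' (FObj T x) (FObj T y) (FObj T z) (FMor T y z K) (FMor T x y J)"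
    by (rule transport_eqI[OF assms x z corr_ray_product[OF o o' over_transport[OF z]
          corr_transport[OF assms x y J] corr_transport[OF assms y z K]]])
qed

text \<open>The correspondence is symmetric under exchanging the coverings, so the transport in the
  other direction must return the original subbimodule.\<close>

lemma transport_inverse:
  assumes dist: "distributive A"
  defines "T' \<equiv> transport M A' A F' F"
  shows "x \<in> Obj A \<Longrightarrow> FObj T' (FObj T x) = x"
    and "x \<in> Obj A \<Longrightarrow> y \<in> Obj A \<Longrightarrow> subbimodule A x y J \<Longrightarrow>
      FMor T' (FObj T x) (FObj T y) (FMor T x y J) = J"
proof -
  interpret S: covering_pair M A' A F' F by (rule swap)
  have obj: "FObj T' (FObj T x) = x" if x: "x \<in> Obj A" for x
    unfolding T'_def
    by (rule S.over_unique[OF S.over_transport over_swap[OF over_transport[OF x]]])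
      (rule overD(2)[OF over_transport[OF x]])
  then show "x \<in> Obj A \<Longrightarrow> FObj T' (FObj T x) = x" .
  assume x: "x \<in> Obj A" and y: "y \<in> Obj A" and J: "subbimodule A x y J"
  have "S.corr (FObj T x) (FObj T' (FObj T x)) (FObj T y) (FObj T' (FObj T y)) (FMor T x y J) J"
    unfolding obj[OF x] obj[OF y] by (rule corresponding_swap[OF corr_transport[OF dist x y J]])
  then show "FMor T' (FObj T x) (FObj T y) (FMor T x y J) = J"
    unfolding T'_def
    by (rule S.transport_eqI[OF distributive_transfer[OF dist] overD(2)[OF over_transport[OF x]]
          overD(2)[OF over_transport[OF y]]])
qed

lemma stem_ray_equivalent:
  assumes dist: "distributive A"
  shows "equivalent_categories (stem_category A) (stem_category A')"
    and "equivalent_categories (ray_category A) (ray_category A')"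
proof -
  interpret S: covering_pair M A' A F' F by (rule swap)
  have dist': "distributive A'" by (rule distributive_transfer[OF dist])
  interpret D: dist_cat A by unfold_locales (rule dist)
  interpret D': dist_cat A' by unfold_locales (rule dist')
  note inv = transport_inverse[OF dist] S.transport_inverse[OF dist']
  show "equivalent_categories (stem_category A) (stem_category A')"
    by (rule inverse_functors_equivalent[OF C.N.stem_is_category C'.N.stem_is_category
          transport_stem_functor[OF dist] S.transport_stem_functor[OF dist']])
      (simp_all add: stem_category_def inv)
  show "equivalent_categories (ray_category A) (ray_category A')"
    by (rule inverse_functors_equivalent[OF D.ray_is_category D'.ray_is_category
          transport_ray_functor[OF dist] S.transport_ray_functor[OF dist']])
      (simp_all add: ray_category_def inv)
qed

end

theorem theorem12:
  fixes At :: "('k::alg_closed_field, 'o, 'm::ab_group_add) kcategory"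
    and A :: "('k, 'p, 'n::ab_group_add) kcategory"
    and A' :: "('k, 'q, 'l::ab_group_add) kcategory"
    and F :: "('o, 'm, 'p, 'n) cat_functor"
    and F' :: "('o, 'm, 'q, 'l) cat_functor"
  assumes "locally_bounded At" and "locally_bounded A" and "locally_bounded A'"
    and "covering_functor At A F" and "covering_functor At A' F'"
    and "directed At"
    and "\<forall>x\<in>Obj At. \<forall>y\<in>Obj At. FObj F x = FObj F y \<longleftrightarrow> FObj F' x = FObj F' y"
  shows "(distributive A \<longleftrightarrow> distributive A') \<and>
         (regular A \<longleftrightarrow> regular A') \<and>
         (distributive A \<longrightarrow>
            equivalent_categories (stem_category A) (stem_category A') \<and>
            equivalent_categories (ray_category A) (ray_category A'))"
proof -
  interpret covering_pair At A A' F F'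
    using assms by unfold_locales auto
  interpret S: covering_pair At A' A F' F by (rule swap)
  show ?thesis
    using distributive_transfer S.distributive_transfer regular_transfer S.regular_transfer
      stem_ray_equivalent by blast
qed

end
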